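(* Let $X$ be a small category. Every discrete fibration $A$ over $X$ has a complement $\neg A:\mathbf{Set}\to\mathbf{Cat}/X$ (a right adjoint of $\mathrm{ten}(A,-):\mathbf{Cat}/X\to\mathbf{Set}$), given by $\neg A=(\Gamma^{*}-)^{A}$, and $\neg A$ takes values in discrete opfibrations over $X$. Conversely, every discrete opfibration $D$ over $X$ has a complement $\neg D=(\Gamma^{*}-)^{D}:\mathbf{Set}\to\mathbf{Cat}/X$, taking values in discrete fibrations over $X$. So, for every set $S$, the $S$-complement $(\neg A)S$ of a discrete fibration $A$ is a discrete opfibration, and the $S$-complement $(\neg D)S$ of a discrete opfibration $D$ is a discrete fibration.
   Context: $\mathbf{Cat}/X$ is the slice category: objects are functors $\pi:P\to X$ with $P$ small (denoted simply $P$), morphisms are functors commuting with the projections to $X$. $P$ is a discrete fibration (df) if for every object $a$ of $P$ and every arrow $f:y\to\pi a$ of $X$ there is a unique arrow of $P$ with codomain $a$ lying over $f$; a discrete opfibration (dof) is defined dually (unique lifts of arrows $f:\pi a\to y$ with domain $a$). There are adjoint functors $\Gamma_!\dashv\Gamma^{*}\dashv\Gamma_*:\mathbf{Cat}/X\to\mathbf{Set}$, where $\Gamma_!P$ is the set of connected components of the total category $P$, $\Gamma^{*}S$ is the projection $S\times X\to X$ (with $S$ a discrete category), and $\Gamma_*P$ is the set of sections of $\pi$. The tensor functor is $\mathrm{ten}(P,Q)=\Gamma_!(P\times Q)$, the product being taken in $\mathbf{Cat}/X$ (i.e. the pullback $P\times_X Q$). For $P\in\mathbf{Cat}/X$, the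 complement $\neg P:\mathbf{Set}\to\mathbf{Cat}/X$ is the right adjoint of $\mathrm{ten}(P,-)$, when it exists; its value $(\neg P)S$ at a set $S$ is called the $S$-complement of $P$. $(\Gamma^{*}S)^{P}$ denotes the exponential in $\mathbf{Cat}/X$. *)

theory Defs
  imports Main "HOL-Library.FuncSet"
begin

text \<open>
  The objects and the arrows of a category form HOL sets, so every category below is small. HOL has
  no type that can serve as a universe of sets closed under exponentials; hence \<open>Set\<close> and \<open>Cat/X\<close>
  are given for every choice of underlying types, and type variables range over these choices.
  Maps and functors are extensional (\<open>undefined\<close> outside their domain), so that equality in hom-sets
  is equality on the domain.
\<close>

record ('o, 'm) cat =
  Obj :: "'o set"
  Arr :: "'m set"
  Dom :: "'m \<Rightarrow> 'o"
  Cod :: "'m \<Rightarrow> 'o"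
  Id :: "'o \<Rightarrow> 'm"
  Comp :: "'m \<Rightarrow> 'm \<Rightarrow> 'm"  \<comment> \<open>\<open>Comp C g f\<close> is \<open>g\<close> after \<open>f\<close>\<close>

locale category =
  fixes C :: "('o, 'm) cat"
  assumes Dom_in: "f \<in> Arr C \<Longrightarrow> Dom C f \<in> Obj C"
    and Cod_in: "f \<in> Arr C \<Longrightarrow> Cod C f \<in> Obj C"
    and Id_in: "x \<in> Obj C \<Longrightarrow> Id C x \<in> Arr C"
    and Dom_Id: "x \<in> Obj C \<Longrightarrow> Dom C (Id C x) = x"
    and Cod_Id: "x \<in> Obj C \<Longrightarrow> Cod C (Id C x) = x"
    and Comp_in: "\<lbrakk>f \<in> Arr C; g \<in> Arr C; Cod C f = Dom C g\<rbrakk> \<Longrightarrow> Comp C g f \<in> Arr C"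
    and Dom_Comp: "\<lbrakk>f \<in> Arr C; g \<in> Arr C; Cod C f = Dom C g\<rbrakk> \<Longrightarrow> Dom C (Comp C g f) = Dom C f"
    and Cod_Comp: "\<lbrakk>f \<in> Arr C; g \<in> Arr C; Cod C f = Dom C g\<rbrakk> \<Longrightarrow> Cod C (Comp C g f) = Cod C g"
    and Comp_Id: "f \<in> Arr C \<Longrightarrow> Comp C f (Id C (Dom C f)) = f"
    and Id_Comp: "f \<in> Arr C \<Longrightarrow> Comp C (Id C (Cod C f)) f = f"
    and Comp_assoc: "\<lbrakk>f \<in> Arr C; g \<in> Arr C; h \<in> Arr C; Cod C f = Dom C g; Cod C g = Dom C h\<rbrakk>
      \<Longrightarrow> Comp C h (Comp C g f) = Comp C (Comp C h g) f"

record ('o, 'm, 'p, 'n) fctr =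
  fo :: "'o \<Rightarrow> 'p"
  fm :: "'m \<Rightarrow> 'n"

definition functors :: "('o, 'm) cat \<Rightarrow> ('p, 'n) cat \<Rightarrow> ('o, 'm, 'p, 'n) fctr set" where
  "functors C D = {F.
     fo F \<in> Obj C \<rightarrow>\<^sub>E Obj D \<and>
     fm F \<in> Arr C \<rightarrow>\<^sub>E Arr D \<and>
     (\<forall>f\<in>Arr C. Dom D (fm F f) = fo F (Dom C f) \<and> Cod D (fm F f) = fo F (Cod C f)) \<and>
     (\<forall>x\<in>Obj C. fm F (Id C x) = Id D (fo F x)) \<and>
     (\<forall>f\<in>Arr C. \<forall>g\<in>Arr C. Cod C f = Dom C g \<longrightarrow> fm F (Comp C g f) = Comp D (fm F g) (fm F f))}"

definition fid :: "('o, 'm) cat \<Rightarrow> ('o, 'm, 'o, 'm) fctr" where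
  "fid C = \<lparr>fo = (\<lambda>x\<in>Obj C. x), fm = (\<lambda>f\<in>Arr C. f)\<rparr>"

definition fcomp ::
  "('o, 'm) cat \<Rightarrow> ('p, 'n, 'q, 'r) fctr \<Rightarrow> ('o, 'm, 'p, 'n) fctr \<Rightarrow> ('o, 'm, 'q, 'r) fctr" where
  "fcomp C G F = \<lparr>fo = compose (Obj C) (fo G) (fo F), fm = compose (Arr C) (fm G) (fm F)\<rparr>"


section \<open>The categories \<open>Set\<close> and \<open>Cat/X\<close>\<close>

text \<open>Arrows of these two categories are triples (domain, map, codomain).\<close>

definition map_of_arr :: "'a \<times> 'f \<times> 'b \<Rightarrow> 'f" where
  "map_of_arr u = fst (snd u)"

definition set_hom :: "'s set \<Rightarrow> 't set \<Rightarrow> ('s \<Rightarrow> 't) set" where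
  "set_hom S T = S \<rightarrow>\<^sub>E T"

type_synonym 's set_arr = "'s set \<times> ('s \<Rightarrow> 's) \<times> 's set"

definition set_cat :: "('s set, 's set_arr) cat" where
  "set_cat = \<lparr>
     Obj = UNIV,
     Arr = {(S, u, T). u \<in> set_hom S T},
     Dom = (\<lambda>(S, u, T). S),
     Cod = (\<lambda>(S, u, T). T),
     Id = (\<lambda>S. (S, (\<lambda>s\<in>S. s), S)),
     Comp = (\<lambda>(T, v, U) (S, u, T'). (S, compose S v u, U))\<rparr>"

record ('o, 'm, 'x, 'y) over =
  tot :: "('o, 'm) cat"
  proj :: "('o, 'm, 'x, 'y) fctr"

definition slice_objs :: "('x, 'y) cat \<Rightarrow> ('o, 'm, 'x, 'y) over set" where
  "slice_objs X = {P. category (tot P) \<and> proj P \<in> functors (tot P) X}"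

definition slice_hom ::
  "('o, 'm, 'x, 'y) over \<Rightarrow> ('p, 'n, 'x, 'y) over \<Rightarrow> ('o, 'm, 'p, 'n) fctr set" where
  "slice_hom P Q = {F \<in> functors (tot P) (tot Q). fcomp (tot P) (proj Q) F = proj P}"

type_synonym ('o, 'm, 'x, 'y) over_arr =
  "('o, 'm, 'x, 'y) over \<times> ('o, 'm, 'o, 'm) fctr \<times> ('o, 'm, 'x, 'y) over"

definition slice_cat ::
  "('x, 'y) cat \<Rightarrow> (('o, 'm, 'x, 'y) over, ('o, 'm, 'x, 'y) over_arr) cat" where
  "slice_cat X = \<lparr>
     Obj = slice_objs X,
     Arr = {(P, F, Q). P \<in> slice_objs X \<and> Q \<in> slice_objs X \<and> F \<in> slice_hom P Q},
     Dom = (\<lambda>(P, F, Q). P),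
     Cod = (\<lambda>(P, F, Q). Q),
     Id = (\<lambda>P. (P, fid (tot P), P)),
     Comp = (\<lambda>(Q, G, R) (P, F, Q'). (P, fcomp (tot P) G F, R))\<rparr>"

definition discrete_fibration :: "('x, 'y) cat \<Rightarrow> ('o, 'm, 'x, 'y) over \<Rightarrow> bool" where
  "discrete_fibration X P \<longleftrightarrow> P \<in> slice_objs X \<and>
     (\<forall>a\<in>Obj (tot P). \<forall>f\<in>Arr X. Cod X f = fo (proj P) a \<longrightarrow>
        (\<exists>!\<alpha>. \<alpha> \<in> Arr (tot P) \<and> Cod (tot P) \<alpha> = a \<and> fm (proj P) \<alpha> = f))"

definition discrete_opfibration :: "('x, 'y) cat \<Rightarrow> ('o, 'm, 'x, 'y) over \<Rightarrow> bool" where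
  "discrete_opfibration X P \<longleftrightarrow> P \<in> slice_objs X \<and>
     (\<forall>a\<in>Obj (tot P). \<forall>f\<in>Arr X. Dom X f = fo (proj P) a \<longrightarrow>
        (\<exists>!\<alpha>. \<alpha> \<in> Arr (tot P) \<and> Dom (tot P) \<alpha> = a \<and> fm (proj P) \<alpha> = f))"


section \<open>Products in \<open>Cat/X\<close>, the functors \<open>\<Gamma>\<^sub>!\<close> and \<open>\<Gamma>\<^sup>*\<close>, and the tensor functor\<close>

definition fprod :: "('o, 'm, 'x, 'y) over \<Rightarrow> ('p, 'n, 'x, 'y) over \<Rightarrow> ('o \<times> 'p, 'm \<times> 'n, 'x, 'y) over" where
  "fprod P Q = (let
      Ob = {(a, b). a \<in> Obj (tot P) \<and> b \<in> Obj (tot Q) \<and> fo (proj P) a = fo (proj Q) b};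
      Ar = {(\<alpha>, \<beta>). \<alpha> \<in> Arr (tot P) \<and> \<beta> \<in> Arr (tot Q) \<and> fm (proj P) \<alpha> = fm (proj Q) \<beta>}
    in \<lparr>
      tot = \<lparr>
        Obj = Ob,
        Arr = Ar,
        Dom = map_prod (Dom (tot P)) (Dom (tot Q)),
        Cod = map_prod (Cod (tot P)) (Cod (tot Q)),
        Id = map_prod (Id (tot P)) (Id (tot Q)),
        Comp = (\<lambda>(\<alpha>', \<beta>') (\<alpha>, \<beta>). (Comp (tot P) \<alpha>' \<alpha>, Comp (tot Q) \<beta>' \<beta>))\<rparr>,
      proj = \<lparr>fo = (\<lambda>(a, b)\<in>Ob. fo (proj P) a), fm = (\<lambda>(\<alpha>, \<beta>)\<in>Ar. fm (proj P) \<alpha>)\<rparr>\<rparr>)"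

definition id_times ::
  "('o, 'm, 'x, 'y) over \<Rightarrow> ('p, 'n, 'x, 'y) over \<Rightarrow> ('p, 'n, 'q, 'r) fctr \<Rightarrow>
   ('o \<times> 'p, 'm \<times> 'n, 'o \<times> 'q, 'm \<times> 'r) fctr" where
  "id_times P Q F = \<lparr>
     fo = (\<lambda>(a, b)\<in>Obj (tot (fprod P Q)). (a, fo F b)),
     fm = (\<lambda>(\<alpha>, \<beta>)\<in>Arr (tot (fprod P Q)). (\<alpha>, fm F \<beta>))\<rparr>"

definition times_functor ::
  "('x, 'y) cat \<Rightarrow> ('a, 'b, 'x, 'y) over \<Rightarrow>
   (('o, 'm, 'x, 'y) over, ('o, 'm, 'x, 'y) over_arr,
    ('a \<times> 'o, 'b \<times> 'm, 'x, 'y) over, ('a \<times> 'o, 'b \<times> 'm, 'x, 'y) over_arr) fctr" where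
  "times_functor X P = \<lparr>
     fo = (\<lambda>Q\<in>Obj (slice_cat X). fprod P Q),
     fm = (\<lambda>(Q, F, Q')\<in>Arr (slice_cat X). (fprod P Q, id_times P Q F, fprod P Q'))\<rparr>"

definition connected :: "('o, 'm) cat \<Rightarrow> ('o \<times> 'o) set" where
  "connected C = (let R = {(Dom C f, Cod C f) | f. f \<in> Arr C}
     in (R \<union> R\<inverse>)\<^sup>* \<inter> Obj C \<times> Obj C)"

definition components :: "('o, 'm) cat \<Rightarrow> 'o set set" where
  "components C = Obj C // connected C"

definition Gamma_shriek ::
  "('x, 'y) cat \<Rightarrow> (('o, 'm, 'x, 'y) over, ('o, 'm, 'x, 'y) over_arr, 'o set set, 'o set set_arr) fctr" where
  "Gamma_shriek X = \<lparr>
     fo = (\<lambda>P\<in>Obj (slice_cat X). components (tot P)),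
     fm = (\<lambda>(P, F, Q)\<in>Arr (slice_cat X).
       (components (tot P), (\<lambda>c\<in>components (tot P). connected (tot Q) `` (fo F ` c)), components (tot Q)))\<rparr>"

definition Gamma_star_obj :: "('x, 'y) cat \<Rightarrow> 's set \<Rightarrow> ('s \<times> 'x, 's \<times> 'y, 'x, 'y) over" where
  "Gamma_star_obj X S = \<lparr>
     tot = \<lparr>
       Obj = S \<times> Obj X,
       Arr = S \<times> Arr X,
       Dom = apsnd (Dom X),
       Cod = apsnd (Cod X),
       Id = apsnd (Id X),
       Comp = (\<lambda>(s, g) (t, f). (s, Comp X g f))\<rparr>,
     proj = \<lparr>fo = restrict snd (S \<times> Obj X), fm = restrict snd (S \<times> Arr X)\<rparr>\<rparr>"

definition Gamma_star ::
  "('x, 'y) cat \<Rightarrow> ('s set, 's set_arr, ('s \<times> 'x, 's \<times> 'y, 'x, 'y) over, ('s \<times> 'x, 's \<times> 'y, 'x, 'y) over_arr) fctr" where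
  "Gamma_star X = \<lparr>
     fo = Gamma_star_obj X,
     fm = (\<lambda>(S, u, T)\<in>Arr set_cat.
       (Gamma_star_obj X S,
        \<lparr>fo = restrict (apfst u) (S \<times> Obj X), fm = restrict (apfst u) (S \<times> Arr X)\<rparr>,
        Gamma_star_obj X T))\<rparr>"

definition ten ::
  "('x, 'y) cat \<Rightarrow> ('a, 'b, 'x, 'y) over \<Rightarrow>
   (('o, 'm, 'x, 'y) over, ('o, 'm, 'x, 'y) over_arr, ('a \<times> 'o) set set, ('a \<times> 'o) set set_arr) fctr" where
  "ten X P = fcomp (slice_cat X) (Gamma_shriek X) (times_functor X P)"


section \<open>Complements and exponentials\<close>

text \<open>
  \<open>right_adjoint X F N \<psi>\<close>: the functor \<open>N\<close> is right adjoint to \<open>F\<close>, where \<open>\<psi> Q S\<close> is the bijection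
  from \<open>Hom(Q, N S)\<close> to \<open>Hom(F Q, S)\<close>, natural in \<open>Q\<close> and \<open>S\<close>. The types of the objects \<open>Q\<close>
  and \<open>N S\<close> of \<open>Cat/X\<close> may differ, and likewise those of the sets \<open>F Q\<close> and \<open>S\<close>.
\<close>

definition right_adjoint ::
  "('x, 'y) cat \<Rightarrow>
   (('o, 'm, 'x, 'y) over, ('o, 'm, 'x, 'y) over_arr, 't set, 't set_arr) fctr \<Rightarrow>
   ('s set, 's set_arr, ('p, 'n, 'x, 'y) over, ('p, 'n, 'x, 'y) over_arr) fctr \<Rightarrow>
   (('o, 'm, 'x, 'y) over \<Rightarrow> 's set \<Rightarrow> ('o, 'm, 'p, 'n) fctr \<Rightarrow> ('t \<Rightarrow> 's)) \<Rightarrow> bool" where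
  "right_adjoint X F N \<psi> \<longleftrightarrow>
     F \<in> functors (slice_cat X) set_cat \<and>
     N \<in> functors set_cat (slice_cat X) \<and>
     (\<forall>Q\<in>slice_objs X. \<forall>S. bij_betw (\<psi> Q S) (slice_hom Q (fo N S)) (set_hom (fo F Q) S)) \<and>
     (\<forall>Q'\<in>slice_objs X. \<forall>Q\<in>slice_objs X. \<forall>K\<in>slice_hom Q' Q. \<forall>S. \<forall>H\<in>slice_hom Q (fo N S).
        \<psi> Q' S (fcomp (tot Q') H K) = compose (fo F Q') (\<psi> Q S H) (map_of_arr (fm F (Q', K, Q)))) \<and>
     (\<forall>Q\<in>slice_objs X. \<forall>S T. \<forall>u\<in>set_hom S T. \<forall>H\<in>slice_hom Q (fo N S).
        \<psi> Q T (fcomp (tot Q) (map_of_arr (fm N (S, u, T))) H) = compose (fo F Q) u (\<psi> Q S H))"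

definition is_complement ::
  "('x, 'y) cat \<Rightarrow> ('a, 'b, 'x, 'y) over \<Rightarrow>
   ('s set, 's set_arr, ('p, 'n, 'x, 'y) over, ('p, 'n, 'x, 'y) over_arr) fctr \<Rightarrow>
   (('o, 'm, 'x, 'y) over \<Rightarrow> 's set \<Rightarrow> ('o, 'm, 'p, 'n) fctr \<Rightarrow> (('a \<times> 'o) set \<Rightarrow> 's)) \<Rightarrow> bool" where
  "is_complement X P N \<psi> \<longleftrightarrow> right_adjoint X (ten X P) N \<psi>"

text \<open>
  \<open>E\<close> with evaluation \<open>ev : P \<times> E \<rightarrow> R\<close> is the exponential \<open>R\<^sup>P\<close> in \<open>Cat/X\<close>; the first argument
  fixes the types of the objects \<open>Q\<close> over which the universal property ranges.
\<close>

definition is_exponential ::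
  "('o \<times> 'm) itself \<Rightarrow> ('x, 'y) cat \<Rightarrow> ('a, 'b, 'x, 'y) over \<Rightarrow> ('c, 'd, 'x, 'y) over \<Rightarrow>
   ('p, 'n, 'x, 'y) over \<Rightarrow> ('a \<times> 'p, 'b \<times> 'n, 'c, 'd) fctr \<Rightarrow> bool" where
  "is_exponential _ X P R E ev \<longleftrightarrow>
     E \<in> slice_objs X \<and> ev \<in> slice_hom (fprod P E) R \<and>
     (\<forall>Q :: ('o, 'm, 'x, 'y) over \<in> slice_objs X.
        bij_betw (\<lambda>H. fcomp (tot (fprod P Q)) ev (id_times P Q H))
          (slice_hom Q E) (slice_hom (fprod P Q) R))"

text \<open>
  \<open>N\<close> is the functor \<open>(\<Gamma>\<^sup>*-)\<^sup>P\<close>: its values are exponentials, and its action on maps is the one induced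
  by the universal property.
\<close>

definition is_exponential_of_Gamma_star ::
  "('o \<times> 'm) itself \<Rightarrow> ('x, 'y) cat \<Rightarrow> ('a, 'b, 'x, 'y) over \<Rightarrow>
   ('s set, 's set_arr, ('p, 'n, 'x, 'y) over, ('p, 'n, 'x, 'y) over_arr) fctr \<Rightarrow>
   ('s set \<Rightarrow> ('a \<times> 'p, 'b \<times> 'n, 's \<times> 'x, 's \<times> 'y) fctr) \<Rightarrow> bool" where
  "is_exponential_of_Gamma_star \<tau> X P N ev \<longleftrightarrow>
     N \<in> functors set_cat (slice_cat X) \<and>
     (\<forall>S. is_exponential \<tau> X P (fo (Gamma_star X) S) (fo N S) (ev S)) \<and>
     (\<forall>S T. \<forall>u\<in>set_hom S T.
        fcomp (tot (fprod P (fo N S))) (ev T) (id_times P (fo N S) (map_of_arr (fm N (S, u, T)))) =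
        fcomp (tot (fprod P (fo N S))) (map_of_arr (fm (Gamma_star X) (S, u, T))) (ev S))"


section \<open>Construction of \<open>(\<Gamma>\<^sup>*-)\<^sup>P\<close>\<close>

text \<open>
  The objects of the exponential \<open>(\<Gamma>\<^sup>*S)\<^sup>P\<close> over \<open>x\<close> are the functors from the fibre of \<open>P\<close> over \<open>x\<close> to the
  discrete category \<open>S\<close>, that is, the maps on the objects of the fibre that are constant along its
  arrows. There is at most one arrow over \<open>f\<close> from \<open>h\<close> to \<open>k\<close>: a functor to \<open>S\<close> from the pullback of \<open>P\<close>
  along \<open>f\<close>, regarded as a functor from the arrow category, that restricts to \<open>h\<close> and \<open>k\<close>. When \<open>P\<close> is a
  discrete fibration or opfibration, these data form a category.
\<close>

definition fibre :: "('a, 'b, 'x, 'y) over \<Rightarrow> 'x \<Rightarrow> 'a set" where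
  "fibre P x = {a \<in> Obj (tot P). fo (proj P) a = x}"

definition gexp_objs :: "('x, 'y) cat \<Rightarrow> ('a, 'b, 'x, 'y) over \<Rightarrow> 's set \<Rightarrow> ('x \<times> ('a \<Rightarrow> 's)) set" where
  "gexp_objs X P S = {(x, h). x \<in> Obj X \<and> h \<in> fibre P x \<rightarrow>\<^sub>E S \<and>
     (\<forall>\<alpha>\<in>Arr (tot P). fm (proj P) \<alpha> = Id X x \<longrightarrow> h (Dom (tot P) \<alpha>) = h (Cod (tot P) \<alpha>))}"

definition gexp_arrs ::
  "('x, 'y) cat \<Rightarrow> ('a, 'b, 'x, 'y) over \<Rightarrow> 's set \<Rightarrow> ('y \<times> ('a \<Rightarrow> 's) \<times> ('a \<Rightarrow> 's)) set" where
  "gexp_arrs X P S = {(f, h, k). f \<in> Arr X \<and>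
     (Dom X f, h) \<in> gexp_objs X P S \<and> (Cod X f, k) \<in> gexp_objs X P S \<and>
     (\<forall>\<alpha>\<in>Arr (tot P). fm (proj P) \<alpha> = f \<longrightarrow> h (Dom (tot P) \<alpha>) = k (Cod (tot P) \<alpha>))}"

definition gexp_obj ::
  "('x, 'y) cat \<Rightarrow> ('a, 'b, 'x, 'y) over \<Rightarrow> 's set \<Rightarrow>
   ('x \<times> ('a \<Rightarrow> 's), 'y \<times> ('a \<Rightarrow> 's) \<times> ('a \<Rightarrow> 's), 'x, 'y) over" where
  "gexp_obj X P S = \<lparr>
     tot = \<lparr>
       Obj = gexp_objs X P S,
       Arr = gexp_arrs X P S,
       Dom = (\<lambda>(f, h, k). (Dom X f, h)),
       Cod = (\<lambda>(f, h, k). (Cod X f, k)),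
       Id = (\<lambda>(x, h). (Id X x, h, h)),
       Comp = (\<lambda>(g, k', l) (f, h, k). (Comp X g f, h, l))\<rparr>,
     proj = \<lparr>fo = restrict fst (gexp_objs X P S), fm = restrict fst (gexp_arrs X P S)\<rparr>\<rparr>"

definition gexp_map ::
  "('x, 'y) cat \<Rightarrow> ('a, 'b, 'x, 'y) over \<Rightarrow> 's set \<Rightarrow> ('s \<Rightarrow> 't) \<Rightarrow>
   ('x \<times> ('a \<Rightarrow> 's), 'y \<times> ('a \<Rightarrow> 's) \<times> ('a \<Rightarrow> 's), 'x \<times> ('a \<Rightarrow> 't), 'y \<times> ('a \<Rightarrow> 't) \<times> ('a \<Rightarrow> 't)) fctr" where
  "gexp_map X P S u = \<lparr>
     fo = (\<lambda>(x, h)\<in>gexp_objs X P S. (x, compose (fibre P x) u h)),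
     fm = (\<lambda>(f, h, k)\<in>gexp_arrs X P S.
       (f, compose (fibre P (Dom X f)) u h, compose (fibre P (Cod X f)) u k))\<rparr>"

definition gexp ::
  "('x, 'y) cat \<Rightarrow> ('a, 'b, 'x, 'y) over \<Rightarrow>
   ('s set, 's set_arr,
    ('x \<times> ('a \<Rightarrow> 's), 'y \<times> ('a \<Rightarrow> 's) \<times> ('a \<Rightarrow> 's), 'x, 'y) over,
    ('x \<times> ('a \<Rightarrow> 's), 'y \<times> ('a \<Rightarrow> 's) \<times> ('a \<Rightarrow> 's), 'x, 'y) over_arr) fctr" where
  "gexp X P = \<lparr>
     fo = gexp_obj X P,
     fm = (\<lambda>(S, u, T)\<in>Arr set_cat. (gexp_obj X P S, gexp_map X P S u, gexp_obj X P T))\<rparr>"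

definition gexp_eval ::
  "('x, 'y) cat \<Rightarrow> ('a, 'b, 'x, 'y) over \<Rightarrow> 's set \<Rightarrow>
   ('a \<times> 'x \<times> ('a \<Rightarrow> 's), 'b \<times> 'y \<times> ('a \<Rightarrow> 's) \<times> ('a \<Rightarrow> 's), 's \<times> 'x, 's \<times> 'y) fctr" where
  "gexp_eval X P S = \<lparr>
     fo = (\<lambda>(a, x, h)\<in>Obj (tot (fprod P (gexp_obj X P S))). (h a, x)),
     fm = (\<lambda>(\<alpha>, f, h, k)\<in>Arr (tot (fprod P (gexp_obj X P S))). (h (Dom (tot P) \<alpha>), f))\<rparr>"

text \<open>
  The transposition \<open>Hom(Q, (\<Gamma>\<^sup>*S)\<^sup>P) \<rightarrow> Hom(P \<times> Q, \<Gamma>\<^sup>*S) \<rightarrow> Hom(\<Gamma>\<^sub>!(P \<times> Q), S)\<close>.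
\<close>

definition Gamma_shriek_transpose ::
  "('o, 'm, 'x, 'y) over \<Rightarrow> ('o, 'm, 's \<times> 'x, 's \<times> 'y) fctr \<Rightarrow> 'o set \<Rightarrow> 's" where
  "Gamma_shriek_transpose P F = (\<lambda>c\<in>components (tot P). the_elem ((\<lambda>p. fst (fo F p)) ` c))"

definition gexp_transpose ::
  "('x, 'y) cat \<Rightarrow> ('a, 'b, 'x, 'y) over \<Rightarrow> ('o, 'm, 'x, 'y) over \<Rightarrow> 's set \<Rightarrow>
   ('o, 'm, 'x \<times> ('a \<Rightarrow> 's), 'y \<times> ('a \<Rightarrow> 's) \<times> ('a \<Rightarrow> 's)) fctr \<Rightarrow> ('a \<times> 'o) set \<Rightarrow> 's" where
  "gexp_transpose X P Q S H =
     Gamma_shriek_transpose (fprod P Q)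
       (fcomp (tot (fprod P Q)) (gexp_eval X P S) (id_times P Q H))"

end

theory Submission
  imports Defs
begin

text \<open>
  A functor \<open>P \<times> Q \<rightarrow> \<Gamma>\<^sup>*S\<close> over \<open>X\<close> is a map on the objects of \<open>P \<times> Q\<close> that is constant along arrows.
  Read as a map on components it transposes to \<open>\<Gamma>\<^sub>!(P \<times> Q) \<rightarrow> S\<close>; read as a family of maps on the fibres
  of \<open>P\<close> indexed by the objects of \<open>Q\<close> it transposes to \<open>Q \<rightarrow> (\<Gamma>\<^sup>*S)\<^sup>P\<close>. Hence \<open>(\<Gamma>\<^sup>*-)\<^sup>P\<close> is the complement
  of \<open>P\<close> as soon as \<open>(\<Gamma>\<^sup>*S)\<^sup>P\<close> is a category. If \<open>P\<close> is a discrete fibration, an arrow \<open>f : x \<rightarrow> y\<close> gives a map from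
  the fibre over \<open>y\<close> to the fibre over \<open>x\<close>, and precomposition with it is the unique way to transport a map
  on the fibre over \<open>x\<close> along \<open>f\<close>; dually for discrete opfibrations.
\<close>

section \<open>Functors and \<open>Cat/X\<close>\<close>

lemma functorsI:
  assumes "fo F \<in> extensional (Obj C)" and "fm F \<in> extensional (Arr C)"
    and "\<And>x. x \<in> Obj C \<Longrightarrow> fo F x \<in> Obj D" and "\<And>f. f \<in> Arr C \<Longrightarrow> fm F f \<in> Arr D"
    and "\<And>f. f \<in> Arr C \<Longrightarrow> Dom D (fm F f) = fo F (Dom C f)"
    and "\<And>f. f \<in> Arr C \<Longrightarrow> Cod D (fm F f) = fo F (Cod C f)"
    and "\<And>x. x \<in> Obj C \<Longrightarrow> fm F (Id C x) = Id D (fo F x)"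
    and "\<And>f g. \<lbrakk>f \<in> Arr C; g \<in> Arr C; Cod C f = Dom C g\<rbrakk>
      \<Longrightarrow> fm F (Comp C g f) = Comp D (fm F g) (fm F f)"
  shows "F \<in> functors C D"
  using assms by (auto simp: functors_def PiE_def)

lemma functorsD:
  assumes "F \<in> functors C D"
  shows functors_fo: "x \<in> Obj C \<Longrightarrow> fo F x \<in> Obj D"
    and functors_fm: "f \<in> Arr C \<Longrightarrow> fm F f \<in> Arr D"
    and functors_Dom: "f \<in> Arr C \<Longrightarrow> Dom D (fm F f) = fo F (Dom C f)"
    and functors_Cod: "f \<in> Arr C \<Longrightarrow> Cod D (fm F f) = fo F (Cod C f)"
    and functors_Id: "x \<in> Obj C \<Longrightarrow> fm F (Id C x) = Id D (fo F x)"
    and functors_Comp: "\<lbrakk>f \<in> Arr C; g \<in> Arr C; Cod C f = Dom C g\<rbrakk>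
      \<Longrightarrow> fm F (Comp C g f) = Comp D (fm F g) (fm F f)"
    and functors_fo_extensional: "fo F \<in> extensional (Obj C)"
    and functors_fm_extensional: "fm F \<in> extensional (Arr C)"
  using assms by (auto simp: functors_def PiE_def)

text \<open>Functor records are \<open>undefined\<close> outside the source category and do not
  store their codomain, so agreement on the source suffices even when the stated targets
  differ.\<close>

lemma functors_eqI:
  assumes "F \<in> functors C D" and "G \<in> functors C D'"
    and "\<And>x. x \<in> Obj C \<Longrightarrow> fo F x = fo G x" and "\<And>f. f \<in> Arr C \<Longrightarrow> fm F f = fm G f"
  shows "F = G"
  using assms
  by (intro fctr.equality)
     (auto intro: extensionalityI functors_fo_extensional functors_fm_extensional)

lemma fcomp_fo [simp]: "x \<in> Obj C \<Longrightarrow> fo (fcomp C G F) x = fo G (fo F x)"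
  and fcomp_fm [simp]: "f \<in> Arr C \<Longrightarrow> fm (fcomp C G F) f = fm G (fm F f)"
  by (auto simp: fcomp_def compose_def)

lemma fcomp_in_functors:
  assumes "category C" and "F \<in> functors C D" and "G \<in> functors D E"
  shows "fcomp C G F \<in> functors C E"
proof -
  interpret C: category C by fact
  note F = functorsD[OF assms(2)] and G = functorsD[OF assms(3)]
  show ?thesis
    by (rule functorsI)
       (auto simp: F G C.Dom_in C.Cod_in C.Id_in C.Comp_in, auto simp: fcomp_def)
qed

lemma fid_in_functors:
  assumes "category C"
  shows "fid C \<in> functors C C"
proof -
  interpret C: category C by fact
  show ?thesis
    by (rule functorsI) (auto simp: fid_def C.Dom_in C.Cod_in C.Id_in C.Comp_in)
qed

lemma slice_objsD:
  assumes "P \<in> slice_objs X"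
  shows slice_objs_category: "category (tot P)" and slice_objs_proj: "proj P \<in> functors (tot P) X"
  using assms by (auto simp: slice_objs_def)

lemma slice_homD:
  assumes "F \<in> slice_hom P Q"
  shows slice_hom_functor: "F \<in> functors (tot P) (tot Q)"
    and slice_hom_fo: "a \<in> Obj (tot P) \<Longrightarrow> fo (proj Q) (fo F a) = fo (proj P) a"
    and slice_hom_fm: "\<alpha> \<in> Arr (tot P) \<Longrightarrow> fm (proj Q) (fm F \<alpha>) = fm (proj P) \<alpha>"
proof -
  have eq: "fcomp (tot P) (proj Q) F = proj P" and "F \<in> functors (tot P) (tot Q)"
    using assms by (auto simp: slice_hom_def)
  then show "F \<in> functors (tot P) (tot Q)" by simp
  show "fo (proj Q) (fo F a) = fo (proj P) a" if "a \<in> Obj (tot P)"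
    using that fcomp_fo[of a "tot P" "proj Q" F] eq by simp
  show "fm (proj Q) (fm F \<alpha>) = fm (proj P) \<alpha>" if "\<alpha> \<in> Arr (tot P)"
    using that fcomp_fm[of \<alpha> "tot P" "proj Q" F] eq by simp
qed

lemma slice_homI:
  assumes "P \<in> slice_objs X" and "Q \<in> slice_objs X" and "F \<in> functors (tot P) (tot Q)"
    and "\<And>a. a \<in> Obj (tot P) \<Longrightarrow> fo (proj Q) (fo F a) = fo (proj P) a"
    and "\<And>\<alpha>. \<alpha> \<in> Arr (tot P) \<Longrightarrow> fm (proj Q) (fm F \<alpha>) = fm (proj P) \<alpha>"
  shows "F \<in> slice_hom P Q"
proof -
  have "fcomp (tot P) (proj Q) F = proj P"
    by (rule functors_eqI[OF fcomp_in_functors])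
       (use assms in \<open>auto intro: slice_objs_category slice_objs_proj\<close>)
  with assms(3) show ?thesis by (simp add: slice_hom_def)
qed

lemma slice_hom_eqI:
  assumes "F \<in> slice_hom P Q" and "G \<in> slice_hom P Q'"
    and "\<And>a. a \<in> Obj (tot P) \<Longrightarrow> fo F a = fo G a" and "\<And>\<alpha>. \<alpha> \<in> Arr (tot P) \<Longrightarrow> fm F \<alpha> = fm G \<alpha>"
  shows "F = G"
  by (rule functors_eqI) (use assms slice_hom_functor in auto)

lemma fid_in_slice_hom:
  assumes "P \<in> slice_objs X"
  shows "fid (tot P) \<in> slice_hom P P"
  by (rule slice_homI[OF assms assms fid_in_functors[OF slice_objs_category[OF assms]]])
     (auto simp: fid_def)

lemma fcomp_in_slice_hom:
  assumes "P \<in> slice_objs X" and "R \<in> slice_objs X"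
    and "F \<in> slice_hom P Q" and "G \<in> slice_hom Q R"
  shows "fcomp (tot P) G F \<in> slice_hom P R"
  by (rule slice_homI[OF assms(1,2)
        fcomp_in_functors[OF slice_objs_category[OF assms(1)]
          slice_hom_functor[OF assms(3)] slice_hom_functor[OF assms(4)]]])
     (auto simp: functorsD[OF slice_hom_functor[OF assms(3)]] slice_homD[OF assms(3)]
       slice_homD[OF assms(4)])

lemma slice_cat_simps [simp]:
  "Obj (slice_cat X) = slice_objs X"
  "(P, F, Q) \<in> Arr (slice_cat X) \<longleftrightarrow> P \<in> slice_objs X \<and> Q \<in> slice_objs X \<and> F \<in> slice_hom P Q"
  "Dom (slice_cat X) (P, F, Q) = P"
  "Cod (slice_cat X) (P, F, Q) = Q"
  "Id (slice_cat X) P = (P, fid (tot P), P)"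
  "Comp (slice_cat X) (Q, G, R) (P, F, Q') = (P, fcomp (tot P) G F, R)"
  by (auto simp: slice_cat_def)

lemma set_cat_simps [simp]:
  "Obj set_cat = UNIV"
  "(S, u, T) \<in> Arr set_cat \<longleftrightarrow> u \<in> set_hom S T"
  "Dom set_cat (S, u, T) = S"
  "Cod set_cat (S, u, T) = T"
  "Id set_cat S = (S, (\<lambda>s\<in>S. s), S)"
  "Comp set_cat (T, v, U) (S, u, T') = (S, compose S v u, U)"
  by (auto simp: set_cat_def)


section \<open>Products\<close>

lemma fprod_simps:
  "Obj (tot (fprod P Q)) =
     {(a, b). a \<in> Obj (tot P) \<and> b \<in> Obj (tot Q) \<and> fo (proj P) a = fo (proj Q) b}"
  "Arr (tot (fprod P Q)) =
     {(\<alpha>, \<beta>). \<alpha> \<in> Arr (tot P) \<and> \<beta> \<in> Arr (tot Q) \<and> fm (proj P) \<alpha> = fm (proj Q) \<beta>}"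
  "Dom (tot (fprod P Q)) (\<alpha>, \<beta>) = (Dom (tot P) \<alpha>, Dom (tot Q) \<beta>)"
  "Cod (tot (fprod P Q)) (\<alpha>, \<beta>) = (Cod (tot P) \<alpha>, Cod (tot Q) \<beta>)"
  "Id (tot (fprod P Q)) (a, b) = (Id (tot P) a, Id (tot Q) b)"
  "Comp (tot (fprod P Q)) (\<alpha>', \<beta>') (\<alpha>, \<beta>) = (Comp (tot P) \<alpha>' \<alpha>, Comp (tot Q) \<beta>' \<beta>)"
  by (auto simp: fprod_def Let_def)

lemma fprod_proj_simps:
  "(a, b) \<in> Obj (tot (fprod P Q)) \<Longrightarrow> fo (proj (fprod P Q)) (a, b) = fo (proj P) a"
  "(\<alpha>, \<beta>) \<in> Arr (tot (fprod P Q)) \<Longrightarrow> fm (proj (fprod P Q)) (\<alpha>, \<beta>) = fm (proj P) \<alpha>"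
  by (auto simp: fprod_def Let_def)

lemma fprod_proj_extensional:
  "fo (proj (fprod P Q)) \<in> extensional (Obj (tot (fprod P Q)))"
  "fm (proj (fprod P Q)) \<in> extensional (Arr (tot (fprod P Q)))"
  by (auto simp: fprod_def Let_def)

lemma fprod_in_slice_objs:
  assumes "P \<in> slice_objs X" and "Q \<in> slice_objs X"
  shows "fprod P Q \<in> slice_objs X"
proof -
  interpret P: category "tot P" using assms(1) by (rule slice_objs_category)
  interpret Q: category "tot Q" using assms(2) by (rule slice_objs_category)
  note p = functorsD[OF slice_objs_proj[OF assms(1)]]
  note q = functorsD[OF slice_objs_proj[OF assms(2)]]
  \<comment> \<open>Arrows with the same image in X have endpoints with the same images, so the
    endpoints of an arrow of the pullback are again objects of it.\<close>
  have peq: "fo (proj P) (Dom (tot P) \<alpha>) = fo (proj Q) (Dom (tot Q) \<beta>)"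
    "fo (proj P) (Cod (tot P) \<alpha>) = fo (proj Q) (Cod (tot Q) \<beta>)"
    if "\<alpha> \<in> Arr (tot P)" "\<beta> \<in> Arr (tot Q)" "fm (proj P) \<alpha> = fm (proj Q) \<beta>" for \<alpha> \<beta>
    using that p(3,4)[of \<alpha>] q(3,4)[of \<beta>] by auto
  have "category (tot (fprod P Q))"
    by unfold_locales
       (auto simp: fprod_simps peq p(5,6) q(5,6) P.Dom_in P.Cod_in P.Id_in P.Dom_Id P.Cod_Id
         P.Comp_in P.Dom_Comp P.Cod_Comp P.Comp_Id P.Id_Comp P.Comp_assoc
         Q.Dom_in Q.Cod_in Q.Id_in Q.Dom_Id Q.Cod_Id
         Q.Comp_in Q.Dom_Comp Q.Cod_Comp Q.Comp_Id Q.Id_Comp Q.Comp_assoc)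
  then interpret PQ: category "tot (fprod P Q)" .
  have "proj (fprod P Q) \<in> functors (tot (fprod P Q)) X"
  proof (rule functorsI)
    fix f g assume "f \<in> Arr (tot (fprod P Q))" "g \<in> Arr (tot (fprod P Q))"
      "Cod (tot (fprod P Q)) f = Dom (tot (fprod P Q)) g"
    then show "fm (proj (fprod P Q)) (Comp (tot (fprod P Q)) g f) =
        Comp X (fm (proj (fprod P Q)) g) (fm (proj (fprod P Q)) f)"
      using PQ.Comp_in[of f g]
      \<comment> \<open>The projection is restricted to the pullback, so its values are rewritten
        while membership is still folded; only afterwards is membership unfolded into
        coordinates.\<close>
      by (cases f; cases g) (auto simp: fprod_proj_simps fprod_simps(6), auto simp: fprod_simps p(6))
  next
    fix f assume f: "f \<in> Arr (tot (fprod P Q))"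
    obtain \<alpha> \<beta> where [simp]: "f = (\<alpha>, \<beta>)" by fastforce
    have "\<alpha> \<in> Arr (tot P)" using f by (simp add: fprod_simps)
    with f PQ.Dom_in[OF f] PQ.Cod_in[OF f]
    show "Dom X (fm (proj (fprod P Q)) f) = fo (proj (fprod P Q)) (Dom (tot (fprod P Q)) f)"
      "Cod X (fm (proj (fprod P Q)) f) = fo (proj (fprod P Q)) (Cod (tot (fprod P Q)) f)"
      by (simp_all add: fprod_proj_simps fprod_simps(3,4) p(3,4))
  next
    fix x assume "x \<in> Obj (tot (fprod P Q))"
    then show "fm (proj (fprod P Q)) (Id (tot (fprod P Q)) x) = Id X (fo (proj (fprod P Q)) x)"
      using PQ.Id_in[of x]
      by (cases x) (auto simp: fprod_proj_simps fprod_simps(5), auto simp: fprod_simps p(5))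
  qed (auto simp: fprod_proj_extensional fprod_proj_simps, auto simp: fprod_simps q(1,2))
  with \<open>category (tot (fprod P Q))\<close> show ?thesis by (simp add: slice_objs_def)
qed

lemma id_times_fo: "(a, b) \<in> Obj (tot (fprod P Q)) \<Longrightarrow> fo (id_times P Q F) (a, b) = (a, fo F b)"
  and id_times_fm: "(\<alpha>, \<beta>) \<in> Arr (tot (fprod P Q)) \<Longrightarrow> fm (id_times P Q F) (\<alpha>, \<beta>) = (\<alpha>, fm F \<beta>)"
  by (auto simp: id_times_def)

text \<open>Acting on the second coordinate stays inside the pullback because \<open>F\<close>
  commutes with the projections to X.\<close>

lemma id_times_in_slice_hom:
  assumes "P \<in> slice_objs X" and "Q \<in> slice_objs X" and "Q' \<in> slice_objs X"
    and "F \<in> slice_hom Q Q'"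
  shows "id_times P Q F \<in> slice_hom (fprod P Q) (fprod P Q')"
proof (rule slice_homI)
  let ?PQ = "fprod P Q"
  interpret PQ: category "tot ?PQ"
    by (rule slice_objs_category[OF fprod_in_slice_objs[OF assms(1,2)]])
  note F = functorsD[OF slice_hom_functor[OF assms(4)]] slice_homD(2,3)[OF assms(4)]
  show "?PQ \<in> slice_objs X" "fprod P Q' \<in> slice_objs X"
    using assms by (auto intro: fprod_in_slice_objs)
  have fo: "fo (id_times P Q F) (a, b) \<in> Obj (tot (fprod P Q'))" if "(a, b) \<in> Obj (tot ?PQ)" for a b
    using that by (auto simp: id_times_fo) (auto simp: fprod_simps F)
  have fm: "fm (id_times P Q F) (\<alpha>, \<beta>) \<in> Arr (tot (fprod P Q'))" if "(\<alpha>, \<beta>) \<in> Arr (tot ?PQ)" for \<alpha> \<beta>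
    using that by (auto simp: id_times_fm) (auto simp: fprod_simps F)
  show "id_times P Q F \<in> functors (tot ?PQ) (tot (fprod P Q'))"
  proof (rule functorsI)
    fix f g assume "f \<in> Arr (tot ?PQ)" "g \<in> Arr (tot ?PQ)" "Cod (tot ?PQ) f = Dom (tot ?PQ) g"
    then show "fm (id_times P Q F) (Comp (tot ?PQ) g f) =
        Comp (tot (fprod P Q')) (fm (id_times P Q F) g) (fm (id_times P Q F) f)"
      using PQ.Comp_in[of f g]
      by (cases f; cases g)
         (auto simp: id_times_fm fprod_simps(6), auto simp: fprod_simps F)
  next
    fix f assume f: "f \<in> Arr (tot ?PQ)"
    obtain \<alpha> \<beta> where [simp]: "f = (\<alpha>, \<beta>)" by fastforce
    have "\<beta> \<in> Arr (tot Q)" using f by (simp add: fprod_simps)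
    with f PQ.Dom_in[OF f] PQ.Cod_in[OF f]
    show "Dom (tot (fprod P Q')) (fm (id_times P Q F) f) = fo (id_times P Q F) (Dom (tot ?PQ) f)"
      "Cod (tot (fprod P Q')) (fm (id_times P Q F) f) = fo (id_times P Q F) (Cod (tot ?PQ) f)"
      by (simp_all add: id_times_fm id_times_fo fprod_simps(3,4) F(3,4))
  next
    fix x assume "x \<in> Obj (tot ?PQ)"
    then show "fm (id_times P Q F) (Id (tot ?PQ) x) = Id (tot (fprod P Q')) (fo (id_times P Q F) x)"
      using PQ.Id_in[of x]
      by (cases x) (auto simp: id_times_fm id_times_fo fprod_simps(5), auto simp: fprod_simps F)
  qed (use fo fm in \<open>auto simp: id_times_def\<close>)
  show "fo (proj (fprod P Q')) (fo (id_times P Q F) a) = fo (proj ?PQ) a" if "a \<in> Obj (tot ?PQ)" for a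
    using that fo[of "fst a" "snd a"] by (cases a) (auto simp: id_times_fo fprod_proj_simps)
  show "fm (proj (fprod P Q')) (fm (id_times P Q F) \<alpha>) = fm (proj ?PQ) \<alpha>"
    if "\<alpha> \<in> Arr (tot ?PQ)" for \<alpha>
    using that fm[of "fst \<alpha>" "snd \<alpha>"] by (cases \<alpha>) (auto simp: id_times_fm fprod_proj_simps)
qed


section \<open>Connected components and the tensor functor\<close>

lemma connected_arr:
  assumes "category C" and "f \<in> Arr C"
  shows "(Dom C f, Cod C f) \<in> connected C"
  using assms by (auto simp: connected_def Let_def category.Dom_in category.Cod_in)

text \<open>Induction along a zigzag of arrows, each traversed in either direction. Values in S and
  components of images both occur as \<phi> below.\<close>

lemma connected_invariant:
  assumes "\<And>f. f \<in> Arr C \<Longrightarrow> \<phi> (Dom C f) = \<phi> (Cod C f)" and "(p, q) \<in> connected C"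
  shows "\<phi> p = \<phi> q"
proof -
  let ?R = "{(Dom C f, Cod C f) | f. f \<in> Arr C}"
  have "(p, q) \<in> (?R \<union> ?R\<inverse>)\<^sup>*"
    using assms(2) by (simp add: connected_def Let_def)
  then show ?thesis
    by (induction rule: rtrancl_induct) (auto dest: assms(1))
qed

text \<open>The reflexive transitive closure is reflexive on the whole type; intersecting with
  \<open>Obj C \<times> Obj C\<close> makes it an equivalence on the objects.\<close>

lemma equiv_connected: "equiv (Obj C) (connected C)"
proof -
  define R where "R = {(Dom C f, Cod C f) | f. f \<in> Arr C}"
  have "sym ((R \<union> R\<inverse>)\<^sup>*)"
    by (intro sym_rtrancl sym_Un_converse)
  moreover have "connected C = (R \<union> R\<inverse>)\<^sup>* \<inter> Obj C \<times> Obj C"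
    by (simp add: connected_def R_def Let_def)
  ultimately show ?thesis
    by (auto intro!: equivI refl_onI symI transI dest: symD intro: rtrancl_trans)
qed

abbreviation component :: "('o, 'm) cat \<Rightarrow> 'o \<Rightarrow> 'o set" where
  "component C p \<equiv> connected C `` {p}"

lemma component_in_components: "p \<in> Obj C \<Longrightarrow> component C p \<in> components C"
  by (simp add: components_def quotientI)

lemma component_self: "p \<in> Obj C \<Longrightarrow> p \<in> component C p"
  using equiv_connected by (rule equiv_class_self)

lemma componentsE:
  assumes "c \<in> components C"
  obtains p where "p \<in> Obj C" and "c = component C p"
  using assms unfolding components_def by (rule quotientE)

lemma component_arr:
  assumes "category C" and "f \<in> Arr C"
  shows "component C (Dom C f) = component C (Cod C f)"
  by (rule equiv_class_eq[OF equiv_connected connected_arr[OF assms]])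

text \<open>A functor sends an arrow to an arrow, so the component of the image is constant along
  arrows; \<open>connected_invariant\<close> extends this to zigzags.\<close>

lemma functor_component_eq:
  assumes "category D" and "F \<in> functors C D" and "(p, q) \<in> connected C"
  shows "component D (fo F p) = component D (fo F q)"
proof (rule connected_invariant[OF _ assms(3)])
  fix f assume "f \<in> Arr C"
  then show "component D (fo F (Dom C f)) = component D (fo F (Cod C f))"
    using component_arr[OF assms(1), of "fm F f"] by (simp add: functorsD[OF assms(2)])
qed

text \<open>The image of a component need not be a whole component. \<open>Gamma_shriek\<close>
  therefore saturates it, and this evaluates the saturation at a representative.\<close>

lemma component_image:
  assumes "category D" and "F \<in> functors C D" and "p \<in> Obj C"
  shows "connected D `` (fo F ` component C p) = component D (fo F p)"
  using functor_component_eq[OF assms(1,2)] component_self[OF assms(3)] by blast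

section \<open>The tensor functor on objects and maps\<close>

lemma ten_fo:
  "Q \<in> slice_objs X \<Longrightarrow> P \<in> slice_objs X \<Longrightarrow> fo (ten X P) Q = components (tot (fprod P Q))"
  by (simp add: ten_def times_functor_def Gamma_shriek_def fprod_in_slice_objs)

lemma ten_fm:
  assumes "P \<in> slice_objs X" and "Q \<in> slice_objs X" and "Q' \<in> slice_objs X" and "F \<in> slice_hom Q Q'"
  shows "fm (ten X P) (Q, F, Q') =
    (components (tot (fprod P Q)),
     (\<lambda>c\<in>components (tot (fprod P Q)). connected (tot (fprod P Q')) `` (fo (id_times P Q F) ` c)),
     components (tot (fprod P Q')))"
  using assms id_times_in_slice_hom[OF assms]
  by (simp add: ten_def times_functor_def Gamma_shriek_def fprod_in_slice_objs)

text \<open>Reduces equations between tensored maps to computations with representatives of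
  components.\<close>

lemma ten_fm_component:
  assumes "P \<in> slice_objs X" and "Q \<in> slice_objs X" and "Q' \<in> slice_objs X" and "F \<in> slice_hom Q Q'"
    and "(a, q) \<in> Obj (tot (fprod P Q))"
  shows "map_of_arr (fm (ten X P) (Q, F, Q')) (component (tot (fprod P Q)) (a, q)) =
    component (tot (fprod P Q')) (a, fo F q)"
  using assms component_image[OF slice_objs_category[OF fprod_in_slice_objs[OF assms(1,3)]]
      slice_hom_functor[OF id_times_in_slice_hom[OF assms(1-4)]] assms(5)]
  by (simp add: ten_fm map_of_arr_def component_in_components id_times_fo)

lemma fprod_map_obj:
  assumes "F \<in> slice_hom Q Q'" and "(a, q) \<in> Obj (tot (fprod P Q))"
  shows "(a, fo F q) \<in> Obj (tot (fprod P Q'))"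
  using assms(2) by (simp add: fprod_simps slice_homD(2)[OF assms(1)]
      functorsD[OF slice_hom_functor[OF assms(1)]])

lemma ten_map_in_set_hom:
  assumes "P \<in> slice_objs X" and "Q \<in> slice_objs X" and "Q' \<in> slice_objs X" and "F \<in> slice_hom Q Q'"
  shows "map_of_arr (fm (ten X P) (Q, F, Q')) \<in>
    set_hom (components (tot (fprod P Q))) (components (tot (fprod P Q')))"
proof -
  have "map_of_arr (fm (ten X P) (Q, F, Q')) c \<in> components (tot (fprod P Q'))"
    if "c \<in> components (tot (fprod P Q))" for c
    using that
  proof (rule componentsE)
    fix p assume p: "p \<in> Obj (tot (fprod P Q))" and "c = component (tot (fprod P Q)) p"
    with ten_fm_component[OF assms, of "fst p" "snd p"] fprod_map_obj[OF assms(4), of "fst p" "snd p"]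
    show ?thesis by (auto intro: component_in_components)
  qed
  then show ?thesis
    using assms by (auto simp: set_hom_def ten_fm map_of_arr_def)
qed

text \<open>Every component has a representative, and off the components both maps are
  \<open>undefined\<close>.\<close>

lemma set_hom_components_eqI:
  assumes "u \<in> set_hom (components C) S" and "v \<in> set_hom (components C) T"
    and "\<And>p. p \<in> Obj C \<Longrightarrow> u (component C p) = v (component C p)"
  shows "u = v"
proof (rule extensionalityI)
  show "u \<in> extensional (components C)" "v \<in> extensional (components C)"
    using assms by (auto simp: set_hom_def PiE_def)
qed (auto elim!: componentsE simp: assms(3))

lemma set_hom_compose: "u \<in> set_hom S T \<Longrightarrow> v \<in> set_hom T U \<Longrightarrow> compose S v u \<in> set_hom S U"
  by (auto simp: set_hom_def compose_def)

text \<open>Both functor laws are equations between maps on components, so they are checked at a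
  representative (a, q): \<open>a\<close> stays fixed, the identity fixes \<open>q\<close>, and a
  composite sends \<open>q\<close> to \<open>G (F q)\<close>.\<close>

lemma ten_in_functors:
  assumes P: "P \<in> slice_objs X"
  shows "ten X P \<in> functors (slice_cat X) set_cat"
proof (rule functorsI)
  show "fo (ten X P) \<in> extensional (Obj (slice_cat X))"
    "fm (ten X P) \<in> extensional (Arr (slice_cat X))"
    by (auto simp: ten_def fcomp_def)
next
  fix h assume h: "h \<in> Arr (slice_cat X)"
  obtain Q F Q' where h_eq: "h = (Q, F, Q')" by (cases h) auto
  with h have *: "Q \<in> slice_objs X" "Q' \<in> slice_objs X" "F \<in> slice_hom Q Q'" by auto
  show "fm (ten X P) h \<in> Arr set_cat"
    using ten_map_in_set_hom[OF P *] by (simp add: h_eq ten_fm[OF P *] map_of_arr_def)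
  show "Dom set_cat (fm (ten X P) h) = fo (ten X P) (Dom (slice_cat X) h)"
    "Cod set_cat (fm (ten X P) h) = fo (ten X P) (Cod (slice_cat X) h)"
    by (simp_all add: h_eq ten_fm[OF P *] ten_fo P *)
next
  fix Q assume "Q \<in> Obj (slice_cat X)"
  then have Q: "Q \<in> slice_objs X" by simp
  note F = Q Q fid_in_slice_hom[OF Q]
  have "map_of_arr (fm (ten X P) (Q, fid (tot Q), Q)) = (\<lambda>c\<in>components (tot (fprod P Q)). c)"
  proof (rule set_hom_components_eqI[OF ten_map_in_set_hom[OF P F]])
    fix p assume p: "p \<in> Obj (tot (fprod P Q))"
    obtain a q where "p = (a, q)" by fastforce
    with p ten_fm_component[OF P F, of a q]
    show "map_of_arr (fm (ten X P) (Q, fid (tot Q), Q)) (component (tot (fprod P Q)) p) =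
        (\<lambda>c\<in>components (tot (fprod P Q)). c) (component (tot (fprod P Q)) p)"
      by (simp add: component_in_components) (simp add: fprod_simps fid_def)
  qed (auto simp: set_hom_def)
  then show "fm (ten X P) (Id (slice_cat X) Q) = Id set_cat (fo (ten X P) Q)"
    by (simp add: ten_fo P Q ten_fm[OF P F] map_of_arr_def)
next
  fix h k assume hk: "h \<in> Arr (slice_cat X)" "k \<in> Arr (slice_cat X)"
    "Cod (slice_cat X) h = Dom (slice_cat X) k"
  obtain Q F R where h_eq: "h = (Q, F, R)" by (cases h) auto
  obtain R' G T where k_eq: "k = (R', G, T)" by (cases k) auto
  have Q: "Q \<in> slice_objs X" and R: "R \<in> slice_objs X" and T: "T \<in> slice_objs X"
    and F: "F \<in> slice_hom Q R" and G: "G \<in> slice_hom R T" and [simp]: "R' = R"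
    using hk by (auto simp: h_eq k_eq)
  note GF = fcomp_in_slice_hom[OF Q T F G]
  have "map_of_arr (fm (ten X P) (Q, fcomp (tot Q) G F, T)) =
    compose (components (tot (fprod P Q))) (map_of_arr (fm (ten X P) (R, G, T)))
      (map_of_arr (fm (ten X P) (Q, F, R)))"
  proof (rule set_hom_components_eqI[OF ten_map_in_set_hom[OF P Q T GF]
        set_hom_compose[OF ten_map_in_set_hom[OF P Q R F] ten_map_in_set_hom[OF P R T G]]])
    fix p assume p: "p \<in> Obj (tot (fprod P Q))"
    obtain a q where [simp]: "p = (a, q)" by fastforce
    have "q \<in> Obj (tot Q)" using p by (simp add: fprod_simps)
    then show "map_of_arr (fm (ten X P) (Q, fcomp (tot Q) G F, T)) (component (tot (fprod P Q)) p) =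
      compose (components (tot (fprod P Q))) (map_of_arr (fm (ten X P) (R, G, T)))
        (map_of_arr (fm (ten X P) (Q, F, R))) (component (tot (fprod P Q)) p)"
      using p fprod_map_obj[OF F, of a q P]
      by (simp add: compose_def component_in_components ten_fm_component[OF P Q T GF]
          ten_fm_component[OF P Q R F] ten_fm_component[OF P R T G])
  qed
  then show "fm (ten X P) (Comp (slice_cat X) k h) = Comp set_cat (fm (ten X P) k) (fm (ten X P) h)"
    by (simp add: h_eq k_eq ten_fm[OF P Q T GF] ten_fm[OF P Q R F] ten_fm[OF P R T G] map_of_arr_def)
qed simp_all


section \<open>The adjunction between \<open>\<Gamma>\<^sub>!\<close> and \<open>\<Gamma>\<^sup>*\<close>\<close>

lemma Gamma_star_obj_simps:
  "Obj (tot (Gamma_star_obj X S)) = S \<times> Obj X"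
  "Arr (tot (Gamma_star_obj X S)) = S \<times> Arr X"
  "Dom (tot (Gamma_star_obj X S)) (s, f) = (s, Dom X f)"
  "Cod (tot (Gamma_star_obj X S)) (s, f) = (s, Cod X f)"
  "Id (tot (Gamma_star_obj X S)) (s, x) = (s, Id X x)"
  "Comp (tot (Gamma_star_obj X S)) (s, g) (t, f) = (s, Comp X g f)"
  "fo (proj (Gamma_star_obj X S)) = restrict snd (S \<times> Obj X)"
  "fm (proj (Gamma_star_obj X S)) = restrict snd (S \<times> Arr X)"
  by (auto simp: Gamma_star_obj_def)

lemma Gamma_star_obj_in_slice_objs:
  assumes "category X"
  shows "Gamma_star_obj X S \<in> slice_objs X"
proof -
  interpret X: category X by fact
  have "category (tot (Gamma_star_obj X S))"
    by unfold_locales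
       (auto simp: Gamma_star_obj_simps X.Dom_in X.Cod_in X.Id_in X.Dom_Id X.Cod_Id
         X.Comp_in X.Dom_Comp X.Cod_Comp X.Comp_Id X.Id_Comp X.Comp_assoc)
  moreover have "proj (Gamma_star_obj X S) \<in> functors (tot (Gamma_star_obj X S)) X"
    by (rule functorsI)
       (auto simp: Gamma_star_obj_simps X.Dom_in X.Cod_in X.Id_in X.Comp_in)
  ultimately show ?thesis by (simp add: slice_objs_def)
qed

text \<open>A map into \<open>\<Gamma>\<^sup>*S\<close> over X carries a single datum, an S-valued
  function on objects that is constant along arrows: the second coordinate is forced by the
  projection, and an arrow (s, f) of \<open>S \<times> X\<close> has \<open>s\<close> in both
  endpoints.\<close>

lemma Gamma_star_hom:
  assumes "W \<in> slice_objs X" and F: "F \<in> slice_hom W (Gamma_star_obj X S)"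
  shows Gamma_star_hom_fo: "p \<in> Obj (tot W) \<Longrightarrow> fo F p = (fst (fo F p), fo (proj W) p)"
    and Gamma_star_hom_fo_in: "p \<in> Obj (tot W) \<Longrightarrow> fst (fo F p) \<in> S"
    and Gamma_star_hom_fm: "\<alpha> \<in> Arr (tot W) \<Longrightarrow> fm F \<alpha> = (fst (fo F (Dom (tot W) \<alpha>)), fm (proj W) \<alpha>)"
    and Gamma_star_hom_arr: "\<alpha> \<in> Arr (tot W) \<Longrightarrow>
      fst (fo F (Dom (tot W) \<alpha>)) = fst (fo F (Cod (tot W) \<alpha>))"
proof -
  note F' = functorsD[OF slice_hom_functor[OF F]] slice_homD(2,3)[OF F]
  show "fo F p = (fst (fo F p), fo (proj W) p)" "fst (fo F p) \<in> S" if "p \<in> Obj (tot W)"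
    using F'(1)[OF that] F'(9)[OF that] by (auto simp: Gamma_star_obj_simps)
  assume \<alpha>: "\<alpha> \<in> Arr (tot W)"
  obtain s f where sf: "fm F \<alpha> = (s, f)" by fastforce
  show "fm F \<alpha> = (fst (fo F (Dom (tot W) \<alpha>)), fm (proj W) \<alpha>)"
    "fst (fo F (Dom (tot W) \<alpha>)) = fst (fo F (Cod (tot W) \<alpha>))"
    using F'(2)[OF \<alpha>] F'(3,4)[OF \<alpha>, symmetric] F'(10)[OF \<alpha>]
    by (auto simp: sf Gamma_star_obj_simps)
qed

text \<open>\<open>the_elem\<close> is legitimate because the S-coordinate is constant along arrows
  and hence takes a single value on each component.\<close>

lemma Gamma_shriek_transpose_component:
  assumes "W \<in> slice_objs X" and "F \<in> slice_hom W (Gamma_star_obj X S)" and p: "p \<in> Obj (tot W)"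
  shows "Gamma_shriek_transpose W F (component (tot W) p) = fst (fo F p)"
proof -
  have "fst (fo F q) = fst (fo F p)" if "(p, q) \<in> connected (tot W)" for q
    using connected_invariant[of "tot W" "\<lambda>q. fst (fo F q)", OF Gamma_star_hom_arr[OF assms(1,2)] that]
    by simp
  then have "(\<lambda>q. fst (fo F q)) ` component (tot W) p = {fst (fo F p)}"
    using component_self[OF p] by blast
  then show ?thesis
    by (simp add: Gamma_shriek_transpose_def component_in_components p)
qed

lemma Gamma_shriek_transpose_in_set_hom:
  assumes "W \<in> slice_objs X" and "F \<in> slice_hom W (Gamma_star_obj X S)"
  shows "Gamma_shriek_transpose W F \<in> set_hom (components (tot W)) S"
proof -
  have "Gamma_shriek_transpose W F c \<in> S" if "c \<in> components (tot W)" for c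
    using that by (rule componentsE)
      (simp add: Gamma_shriek_transpose_component[OF assms] Gamma_star_hom_fo_in[OF assms])
  then show ?thesis by (auto simp: set_hom_def) (simp add: Gamma_shriek_transpose_def)
qed

text \<open>Injective because F is recovered from the S-coordinates of its objects, which are the
  values of the transpose on components. For surjectivity, \<open>u\<close> is pulled back along the
  map from objects to their components.\<close>

lemma Gamma_shriek_transpose_bij:
  assumes "category X" and W: "W \<in> slice_objs X"
  shows "bij_betw (Gamma_shriek_transpose W) (slice_hom W (Gamma_star_obj X S))
    (set_hom (components (tot W)) S)"
proof (rule bij_betwI')
  fix F G assume F: "F \<in> slice_hom W (Gamma_star_obj X S)" and G: "G \<in> slice_hom W (Gamma_star_obj X S)"
  interpret W: category "tot W" using W by (rule slice_objs_category)
  show "Gamma_shriek_transpose W F = Gamma_shriek_transpose W G \<longleftrightarrow> F = G"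
  proof
    assume eq: "Gamma_shriek_transpose W F = Gamma_shriek_transpose W G"
    have fst_eq: "fst (fo F p) = fst (fo G p)" if "p \<in> Obj (tot W)" for p
      using Gamma_shriek_transpose_component[OF W F that] Gamma_shriek_transpose_component[OF W G that]
      by (simp add: eq)
    show "F = G"
    proof (rule slice_hom_eqI[OF F G])
      show "fo F p = fo G p" if "p \<in> Obj (tot W)" for p
        using fst_eq[OF that] Gamma_star_hom_fo[OF W F that] Gamma_star_hom_fo[OF W G that] by metis
      show "fm F \<alpha> = fm G \<alpha>" if "\<alpha> \<in> Arr (tot W)" for \<alpha>
        by (simp add: Gamma_star_hom_fm[OF W F that] Gamma_star_hom_fm[OF W G that] fst_eq W.Dom_in that)
    qed
  qed simp
next
  show "Gamma_shriek_transpose W F \<in> set_hom (components (tot W)) S"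
    if "F \<in> slice_hom W (Gamma_star_obj X S)" for F
    using W that by (rule Gamma_shriek_transpose_in_set_hom)
next
  fix u assume u: "u \<in> set_hom (components (tot W)) S"
  interpret X: category X by fact
  interpret W: category "tot W" using W by (rule slice_objs_category)
  note p = functorsD[OF slice_objs_proj[OF W]]
  \<comment> \<open>An arrow takes its S-coordinate from its domain; by \<open>arr\<close> the
    codomain gives the same one.\<close>
  define F where "F = \<lparr>fo = (\<lambda>p\<in>Obj (tot W). (u (component (tot W) p), fo (proj W) p)),
    fm = (\<lambda>\<alpha>\<in>Arr (tot W). (u (component (tot W) (Dom (tot W) \<alpha>)), fm (proj W) \<alpha>))\<rparr>"
  note arr = component_arr[OF W.category_axioms]
  have uS: "u (component (tot W) q) \<in> S" if "q \<in> Obj (tot W)" for q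
    using u component_in_components[OF that] by (auto simp: set_hom_def)
  have F: "F \<in> slice_hom W (Gamma_star_obj X S)"
  proof (rule slice_homI[OF W Gamma_star_obj_in_slice_objs[OF assms(1)]])
    show "F \<in> functors (tot W) (tot (Gamma_star_obj X S))"
      by (rule functorsI)
         (auto simp: F_def Gamma_star_obj_simps uS p W.Dom_in W.Cod_in W.Id_in W.Dom_Id W.Comp_in
           W.Dom_Comp arr)
  qed (auto simp: F_def Gamma_star_obj_simps uS p W.Dom_in)
  have "u = Gamma_shriek_transpose W F"
  proof (rule set_hom_components_eqI[OF u Gamma_shriek_transpose_in_set_hom[OF W F]])
    show "u (component (tot W) q) = Gamma_shriek_transpose W F (component (tot W) q)"
      if "q \<in> Obj (tot W)" for q
      using that by (simp add: Gamma_shriek_transpose_component[OF W F]) (simp add: F_def)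
  qed
  with F show "\<exists>F\<in>slice_hom W (Gamma_star_obj X S). u = Gamma_shriek_transpose W F" ..
qed


section \<open>Exponentials of constant families\<close>

text \<open>
  Composition in \<open>(\<Gamma>\<^sup>*S)\<^sup>P\<close> only needs that every factorization of \<open>\<pi> \<alpha>\<close> lifts to \<open>P\<close>. This self-dual
  condition covers discrete fibrations and discrete opfibrations simultaneously.
\<close>

locale factorization_lifting = category X for X :: "('x, 'y) cat" +
  fixes P :: "('a, 'b, 'x, 'y) over"
  assumes P_obj: "P \<in> slice_objs X"
    and factorization_lift: "\<lbrakk>\<alpha> \<in> Arr (tot P); f \<in> Arr X; g \<in> Arr X; Cod X f = Dom X g;
        fm (proj P) \<alpha> = Comp X g f\<rbrakk>
      \<Longrightarrow> \<exists>\<beta> \<gamma>. \<beta> \<in> Arr (tot P) \<and> \<gamma> \<in> Arr (tot P) \<and> fm (proj P) \<beta> = f \<and> fm (proj P) \<gamma> = g \<and>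
        Dom (tot P) \<beta> = Dom (tot P) \<alpha> \<and> Cod (tot P) \<beta> = Dom (tot P) \<gamma> \<and>
        Cod (tot P) \<gamma> = Cod (tot P) \<alpha>"

lemma gexp_obj_simps:
  "Obj (tot (gexp_obj X P S)) = gexp_objs X P S"
  "Arr (tot (gexp_obj X P S)) = gexp_arrs X P S"
  "Dom (tot (gexp_obj X P S)) (f, h, k) = (Dom X f, h)"
  "Cod (tot (gexp_obj X P S)) (f, h, k) = (Cod X f, k)"
  "Id (tot (gexp_obj X P S)) (x, h) = (Id X x, h, h)"
  "Comp (tot (gexp_obj X P S)) (g, k', l) (f, h, k) = (Comp X g f, h, l)"
  "fo (proj (gexp_obj X P S)) = restrict fst (gexp_objs X P S)"
  "fm (proj (gexp_obj X P S)) = restrict fst (gexp_arrs X P S)"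
  by (auto simp: gexp_obj_def)

lemma gexp_objsD:
  assumes "(x, h) \<in> gexp_objs X P S"
  shows "x \<in> Obj X" and "h \<in> fibre P x \<rightarrow>\<^sub>E S"
    and "\<lbrakk>\<alpha> \<in> Arr (tot P); fm (proj P) \<alpha> = Id X x\<rbrakk> \<Longrightarrow> h (Dom (tot P) \<alpha>) = h (Cod (tot P) \<alpha>)"
  using assms by (auto simp: gexp_objs_def)

lemma gexp_arrsD:
  assumes "(f, h, k) \<in> gexp_arrs X P S"
  shows "f \<in> Arr X" and "(Dom X f, h) \<in> gexp_objs X P S" and "(Cod X f, k) \<in> gexp_objs X P S"
    and "\<lbrakk>\<alpha> \<in> Arr (tot P); fm (proj P) \<alpha> = f\<rbrakk> \<Longrightarrow> h (Dom (tot P) \<alpha>) = k (Cod (tot P) \<alpha>)"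
  using assms by (auto simp: gexp_arrs_def)

section \<open>The category \<open>(\<Gamma>\<^sup>*S)\<^sup>P\<close> over X\<close>

context factorization_lifting
begin

text \<open>Over an identity of X the compatibility condition of \<open>gexp_arrs\<close> is exactly
  the constancy condition imposed in \<open>gexp_objs\<close>.\<close>

lemma gexp_Id_in: "(x, h) \<in> gexp_objs X P S \<Longrightarrow> (Id X x, h, h) \<in> gexp_arrs X P S"
  by (auto simp: gexp_arrs_def Id_in Dom_Id Cod_Id gexp_objsD)

text \<open>An arrow \<alpha> over the composite has the outer endpoints of a lifted pair \<beta>,
  \<gamma>. So h at its start equals k at the middle object, which equals l at its end.\<close>

lemma gexp_Comp_in:
  assumes f: "(f, h, k) \<in> gexp_arrs X P S" and g: "(g, k, l) \<in> gexp_arrs X P S"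
    and "Cod X f = Dom X g"
  shows "(Comp X g f, h, l) \<in> gexp_arrs X P S"
proof -
  have "h (Dom (tot P) \<alpha>) = l (Cod (tot P) \<alpha>)"
    if \<alpha>: "\<alpha> \<in> Arr (tot P)" "fm (proj P) \<alpha> = Comp X g f" for \<alpha>
  proof -
    obtain \<beta> \<gamma> where "\<beta> \<in> Arr (tot P)" "\<gamma> \<in> Arr (tot P)" "fm (proj P) \<beta> = f" "fm (proj P) \<gamma> = g"
      "Dom (tot P) \<beta> = Dom (tot P) \<alpha>" "Cod (tot P) \<beta> = Dom (tot P) \<gamma>" "Cod (tot P) \<gamma> = Cod (tot P) \<alpha>"
      using factorization_lift[OF \<alpha>(1) gexp_arrsD(1)[OF f] gexp_arrsD(1)[OF g] assms(3) \<alpha>(2)] by blast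
    with gexp_arrsD(4)[OF f, of \<beta>] gexp_arrsD(4)[OF g, of \<gamma>] show ?thesis by simp
  qed
  with gexp_arrsD(1-3)[OF f] gexp_arrsD(1-3)[OF g] assms(3) show ?thesis
    by (simp add: gexp_arrs_def Comp_in Dom_Comp Cod_Comp)
qed

text \<open>An arrow is fixed by its base arrow and its two ends, so the category laws are inherited
  from X once identities and composites are known to be arrows.\<close>

lemma gexp_obj_in_slice_objs: "gexp_obj X P S \<in> slice_objs X"
proof -
  have "category (tot (gexp_obj X P S))"
    by unfold_locales
       (auto simp: gexp_obj_simps gexp_Id_in gexp_Comp_in gexp_objsD(1) gexp_arrsD(1-3)
         Dom_Id Cod_Id Dom_Comp Cod_Comp Comp_Id Id_Comp Comp_assoc)
  moreover have "proj (gexp_obj X P S) \<in> functors (tot (gexp_obj X P S)) X"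
    by (rule functorsI)
       (auto simp: gexp_obj_simps gexp_Id_in gexp_Comp_in gexp_objsD(1) gexp_arrsD(1-3))
  ultimately show ?thesis by (simp add: slice_objs_def)
qed

lemma fibre_Dom_Cod:
  assumes "\<alpha> \<in> Arr (tot P)"
  shows "Dom (tot P) \<alpha> \<in> fibre P (Dom X (fm (proj P) \<alpha>))"
    and "Cod (tot P) \<alpha> \<in> fibre P (Cod X (fm (proj P) \<alpha>))"
proof -
  interpret P: category "tot P" using P_obj by (rule slice_objs_category)
  show "Dom (tot P) \<alpha> \<in> fibre P (Dom X (fm (proj P) \<alpha>))"
    and "Cod (tot P) \<alpha> \<in> fibre P (Cod X (fm (proj P) \<alpha>))"
    using assms by (auto simp: fibre_def P.Dom_in P.Cod_in functorsD[OF slice_objs_proj[OF P_obj]])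
qed

section \<open>Functoriality in the set S\<close>

lemma gexp_map_objs:
  assumes "u \<in> set_hom S T" and "(x, h) \<in> gexp_objs X P S"
  shows "(x, compose (fibre P x) u h) \<in> gexp_objs X P T"
proof -
  have "compose (fibre P x) u h (Dom (tot P) \<alpha>) = compose (fibre P x) u h (Cod (tot P) \<alpha>)"
    if "\<alpha> \<in> Arr (tot P)" "fm (proj P) \<alpha> = Id X x" for \<alpha>
    \<comment> \<open>\<open>compose\<close> is \<open>undefined\<close> off the fibre, so both ends
      of the vertical arrow \<alpha> have to be placed in the fibre over \<open>x\<close>.\<close>
    using fibre_Dom_Cod[OF that(1)] gexp_objsD(1)[OF assms(2)] gexp_objsD(3)[OF assms(2) that]
    by (simp add: that(2) Dom_Id Cod_Id compose_def)
  with assms gexp_objsD(1,2)[OF assms(2)] show ?thesis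
    by (auto simp: gexp_objs_def set_hom_def compose_def)
qed

lemma gexp_map_arrs:
  assumes "u \<in> set_hom S T" and "(f, h, k) \<in> gexp_arrs X P S"
  shows "(f, compose (fibre P (Dom X f)) u h, compose (fibre P (Cod X f)) u k) \<in> gexp_arrs X P T"
proof -
  have "compose (fibre P (Dom X f)) u h (Dom (tot P) \<alpha>) = compose (fibre P (Cod X f)) u k (Cod (tot P) \<alpha>)"
    if "\<alpha> \<in> Arr (tot P)" "fm (proj P) \<alpha> = f" for \<alpha>
    using fibre_Dom_Cod[OF that(1)] gexp_arrsD(4)[OF assms(2) that]
    by (simp add: that(2) compose_def)
  with gexp_map_objs[OF assms(1)] gexp_arrsD(1-3)[OF assms(2)] show ?thesis
    by (simp add: gexp_arrs_def)
qed

lemma gexp_map_in_slice_hom: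
  assumes "u \<in> set_hom S T"
  shows "gexp_map X P S u \<in> slice_hom (gexp_obj X P S) (gexp_obj X P T)"
proof (rule slice_homI[OF gexp_obj_in_slice_objs gexp_obj_in_slice_objs])
  show "gexp_map X P S u \<in> functors (tot (gexp_obj X P S)) (tot (gexp_obj X P T))"
    by (rule functorsI)
       (auto simp: gexp_obj_simps gexp_map_def gexp_map_objs[OF assms] gexp_map_arrs[OF assms]
         gexp_arrsD(1-3) gexp_objsD(1) gexp_Id_in gexp_Comp_in Dom_Id Cod_Id Dom_Comp Cod_Comp)
qed (auto simp: gexp_obj_simps gexp_map_def gexp_map_objs[OF assms] gexp_map_arrs[OF assms])

lemma gexp_in_functors: "gexp X P \<in> functors set_cat (slice_cat X)"
proof (rule functorsI)
  fix S :: "'s set"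
  have "gexp_map X P S (\<lambda>s\<in>S. s) = fid (tot (gexp_obj X P S))"
  proof (rule slice_hom_eqI[OF gexp_map_in_slice_hom fid_in_slice_hom[OF gexp_obj_in_slice_objs]])
    \<comment> \<open>Restricting the identity to S is harmless: on the fibre h takes values in S,
      and elsewhere both sides are \<open>undefined\<close>.\<close>
    have id: "compose (fibre P x) (\<lambda>s\<in>S. s) h = h" if "(x, h) \<in> gexp_objs X P S" for x h
      using gexp_objsD(2)[OF that]
      by (intro extensionalityI[of _ "fibre P x"]) (auto simp: compose_def PiE_def)
    show "fo (gexp_map X P S (\<lambda>s\<in>S. s)) a = fo (fid (tot (gexp_obj X P S))) a"
      if "a \<in> Obj (tot (gexp_obj X P S))" for a
      using that by (cases a) (simp add: gexp_map_def fid_def gexp_obj_simps id)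
    show "fm (gexp_map X P S (\<lambda>s\<in>S. s)) a = fm (fid (tot (gexp_obj X P S))) a"
      if "a \<in> Arr (tot (gexp_obj X P S))" for a
      using that gexp_arrsD(2,3)[of "fst a" "fst (snd a)" "snd (snd a)" X P S]
      by (cases a) (simp add: gexp_map_def fid_def gexp_obj_simps id)
  qed (auto simp: set_hom_def)
  then show "fm (gexp X P) (Id set_cat S) = Id (slice_cat X) (fo (gexp X P) S)"
    by (simp add: gexp_def set_hom_def)
next
  fix p q :: "'s set_arr"
  assume pq: "p \<in> Arr set_cat" "q \<in> Arr set_cat" "Cod set_cat p = Dom set_cat q"
  obtain S u T where p: "p = (S, u, T)" by (cases p) auto
  obtain T' v U where q: "q = (T', v, U)" by (cases q) auto
  have u: "u \<in> set_hom S T" and v: "v \<in> set_hom T U" and [simp]: "T' = T"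
    using pq by (auto simp: p q)
  \<comment> \<open>On the fibre the values of h lie in S, where \<open>compose S v u\<close> is v
    after u; off the fibre both sides are \<open>undefined\<close>.\<close>
  have comp: "compose (fibre P x) (compose S v u) h = compose (fibre P x) v (compose (fibre P x) u h)"
    if "(x, h) \<in> gexp_objs X P S" for x h
    using gexp_objsD(2)[OF that] by (auto simp: compose_def fun_eq_iff)
  have "gexp_map X P S (compose S v u) = fcomp (tot (gexp_obj X P S)) (gexp_map X P T v) (gexp_map X P S u)"
  proof (rule slice_hom_eqI)
    show "gexp_map X P S (compose S v u) \<in> slice_hom (gexp_obj X P S) (gexp_obj X P U)"
      by (rule gexp_map_in_slice_hom[OF set_hom_compose[OF u v]])
    show "fcomp (tot (gexp_obj X P S)) (gexp_map X P T v) (gexp_map X P S u)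
        \<in> slice_hom (gexp_obj X P S) (gexp_obj X P U)"
      by (rule fcomp_in_slice_hom[OF gexp_obj_in_slice_objs gexp_obj_in_slice_objs
            gexp_map_in_slice_hom[OF u] gexp_map_in_slice_hom[OF v]])
    show "fo (gexp_map X P S (compose S v u)) a =
        fo (fcomp (tot (gexp_obj X P S)) (gexp_map X P T v) (gexp_map X P S u)) a"
      if "a \<in> Obj (tot (gexp_obj X P S))" for a
      using that by (cases a) (simp add: gexp_obj_simps, simp add: gexp_map_def comp gexp_map_objs[OF u])
    show "fm (gexp_map X P S (compose S v u)) a =
        fm (fcomp (tot (gexp_obj X P S)) (gexp_map X P T v) (gexp_map X P S u)) a"
      if "a \<in> Arr (tot (gexp_obj X P S))" for a
      using that gexp_arrsD(2,3)[of "fst a" "fst (snd a)" "snd (snd a)" X P S]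
      by (cases a) (simp add: gexp_obj_simps, simp add: gexp_map_def comp gexp_map_arrs[OF u])
  qed
  then show "fm (gexp X P) (Comp set_cat q p) = Comp (slice_cat X) (fm (gexp X P) q) (fm (gexp X P) p)"
    using u v set_hom_compose[OF u v] by (simp add: gexp_def p q)
next
  fix p :: "'s set_arr"
  assume "p \<in> Arr set_cat"
  then show "fm (gexp X P) p \<in> Arr (slice_cat X)"
    "Dom (slice_cat X) (fm (gexp X P) p) = fo (gexp X P) (Dom set_cat p)"
    "Cod (slice_cat X) (fm (gexp X P) p) = fo (gexp X P) (Cod set_cat p)"
    by (cases p; simp add: gexp_def gexp_obj_in_slice_objs gexp_map_in_slice_hom)+
qed (auto simp: gexp_def gexp_obj_in_slice_objs)

section \<open>Evaluation\<close>

lemma gexp_prod_objs: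
  "(a, x, h) \<in> Obj (tot (fprod P (gexp_obj X P S))) \<longleftrightarrow> a \<in> fibre P x \<and> (x, h) \<in> gexp_objs X P S"
  by (auto simp: fprod_simps gexp_obj_simps fibre_def)

lemma gexp_prod_arrs:
  "(\<alpha>, f, h, k) \<in> Arr (tot (fprod P (gexp_obj X P S))) \<longleftrightarrow>
    \<alpha> \<in> Arr (tot P) \<and> fm (proj P) \<alpha> = f \<and> (f, h, k) \<in> gexp_arrs X P S"
  by (auto simp: fprod_simps gexp_obj_simps)

lemma gexp_eval_fo:
  "(a, x, h) \<in> Obj (tot (fprod P (gexp_obj X P S))) \<Longrightarrow> fo (gexp_eval X P S) (a, x, h) = (h a, x)"
  and gexp_eval_fm:
  "(\<alpha>, f, h, k) \<in> Arr (tot (fprod P (gexp_obj X P S))) \<Longrightarrow>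
    fm (gexp_eval X P S) (\<alpha>, f, h, k) = (h (Dom (tot P) \<alpha>), f)"
  by (auto simp: gexp_eval_def)

text \<open>On an arrow (\<alpha>, f, h, k) the condition of \<open>gexp_arrs\<close> equates h at
  the domain of \<alpha> with k at its codomain. That is what an arrow of
  \<open>\<Gamma>\<^sup>*S\<close> needs: one S-coordinate for both endpoints.\<close>

lemma gexp_eval_in_slice_hom:
  "gexp_eval X P S \<in> slice_hom (fprod P (gexp_obj X P S)) (Gamma_star_obj X S)"
proof (rule slice_homI)
  let ?E = "fprod P (gexp_obj X P S)"
  show E: "?E \<in> slice_objs X" by (intro fprod_in_slice_objs P_obj gexp_obj_in_slice_objs)
  interpret E: category "tot ?E" using E by (rule slice_objs_category)
  interpret P: category "tot P" using P_obj by (rule slice_objs_category)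
  show "Gamma_star_obj X S \<in> slice_objs X"
    by (rule Gamma_star_obj_in_slice_objs[OF category_axioms])
  have value_in: "h a \<in> S" if "(a, x, h) \<in> Obj (tot ?E)" for a x h
    using that gexp_objsD(2)[of x h X P S] by (auto simp: gexp_prod_objs)
  have arr: "(Dom (tot P) \<alpha>, Dom X f, h) \<in> Obj (tot ?E)" "(Cod (tot P) \<alpha>, Cod X f, k) \<in> Obj (tot ?E)"
    "h (Dom (tot P) \<alpha>) = k (Cod (tot P) \<alpha>)" "f \<in> Arr X" "\<alpha> \<in> Arr (tot P)"
    if "(\<alpha>, f, h, k) \<in> Arr (tot ?E)" for \<alpha> f h k
    using that fibre_Dom_Cod[of \<alpha>] gexp_arrsD[of f h k X P S]
    by (auto simp: gexp_prod_arrs gexp_prod_objs)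
  show "gexp_eval X P S \<in> functors (tot ?E) (tot (Gamma_star_obj X S))"
  proof (rule functorsI)
    fix p assume p: "p \<in> Obj (tot ?E)"
    obtain a x h where [simp]: "p = (a, x, h)" by (cases p) auto
    show "fo (gexp_eval X P S) p \<in> Obj (tot (Gamma_star_obj X S))"
      using p value_in[of a x h]
      by (simp add: gexp_eval_fo Gamma_star_obj_simps) (auto simp: gexp_prod_objs gexp_objsD(1))
    have "a \<in> Obj (tot P)" using p by (auto simp: gexp_prod_objs fibre_def)
    with p E.Id_in[OF p] show "fm (gexp_eval X P S) (Id (tot ?E) p) =
        Id (tot (Gamma_star_obj X S)) (fo (gexp_eval X P S) p)"
      by (simp add: fprod_simps(5) gexp_obj_simps(5) gexp_eval_fm gexp_eval_fo
          Gamma_star_obj_simps P.Dom_Id)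
  next
    fix p assume p: "p \<in> Arr (tot ?E)"
    obtain \<alpha> f h k where [simp]: "p = (\<alpha>, f, h, k)" by (cases p) auto
    show "fm (gexp_eval X P S) p \<in> Arr (tot (Gamma_star_obj X S))"
      "Dom (tot (Gamma_star_obj X S)) (fm (gexp_eval X P S) p) = fo (gexp_eval X P S) (Dom (tot ?E) p)"
      "Cod (tot (Gamma_star_obj X S)) (fm (gexp_eval X P S) p) = fo (gexp_eval X P S) (Cod (tot ?E) p)"
      using p arr[of \<alpha> f h k] value_in[of "Dom (tot P) \<alpha>" "Dom X f" h]
      by (simp_all add: gexp_eval_fm gexp_eval_fo Gamma_star_obj_simps fprod_simps(3,4)
          gexp_obj_simps(3,4))
  next
    fix p q assume pq: "p \<in> Arr (tot ?E)" "q \<in> Arr (tot ?E)" "Cod (tot ?E) p = Dom (tot ?E) q"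
    obtain \<alpha> f h k where [simp]: "p = (\<alpha>, f, h, k)" by (cases p) auto
    obtain \<beta> g k' l where [simp]: "q = (\<beta>, g, k', l)" by (cases q) auto
    show "fm (gexp_eval X P S) (Comp (tot ?E) q p) =
        Comp (tot (Gamma_star_obj X S)) (fm (gexp_eval X P S) q) (fm (gexp_eval X P S) p)"
      using pq E.Comp_in[OF pq] arr[of \<alpha> f h k] arr[of \<beta> g k' l]
      by (simp add: gexp_eval_fm Gamma_star_obj_simps fprod_simps(3,4,6) gexp_obj_simps(3,4,6)
          P.Dom_Comp)
  qed (auto simp: gexp_eval_def)
  show "fo (proj (Gamma_star_obj X S)) (fo (gexp_eval X P S) p) = fo (proj ?E) p"
    if "p \<in> Obj (tot ?E)" for p
    using that value_in[of "fst p" "fst (snd p)" "snd (snd p)"]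
    by (cases p) (auto simp: gexp_eval_fo fprod_proj_simps Gamma_star_obj_simps,
        auto simp: gexp_prod_objs gexp_objsD(1) fibre_def)
  show "fm (proj (Gamma_star_obj X S)) (fm (gexp_eval X P S) p) = fm (proj ?E) p"
    if p: "p \<in> Arr (tot ?E)" for p
  proof -
    obtain \<alpha> f h k where [simp]: "p = (\<alpha>, f, h, k)" by (cases p) auto
    show ?thesis
      using p arr[of \<alpha> f h k] value_in[of "Dom (tot P) \<alpha>" "Dom X f" h]
      by (simp add: gexp_eval_fm fprod_proj_simps Gamma_star_obj_simps) (simp add: gexp_prod_arrs)
  qed
qed

section \<open>Currying and uncurrying\<close>

lemma gexp_hom:
  assumes Q: "Q \<in> slice_objs X" and H: "H \<in> slice_hom Q (gexp_obj X P S)"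
  shows gexp_hom_fo: "q \<in> Obj (tot Q) \<Longrightarrow> fo H q = (fo (proj Q) q, snd (fo H q))"
    and gexp_hom_fm: "\<beta> \<in> Arr (tot Q) \<Longrightarrow>
      fm H \<beta> = (fm (proj Q) \<beta>, snd (fo H (Dom (tot Q) \<beta>)), snd (fo H (Cod (tot Q) \<beta>)))"
    and gexp_hom_value: "q \<in> Obj (tot Q) \<Longrightarrow> snd (fo H q) \<in> fibre P (fo (proj Q) q) \<rightarrow>\<^sub>E S"
proof -
  note H' = functorsD[OF slice_hom_functor[OF H]] slice_homD(2,3)[OF H]
  show "fo H q = (fo (proj Q) q, snd (fo H q))"
    "snd (fo H q) \<in> fibre P (fo (proj Q) q) \<rightarrow>\<^sub>E S" if "q \<in> Obj (tot Q)"
    using H'(1)[OF that] H'(9)[OF that] gexp_objsD(2)[of "fst (fo H q)" "snd (fo H q)" X P S]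
    by (cases "fo H q"; simp add: gexp_obj_simps)+
  assume \<beta>: "\<beta> \<in> Arr (tot Q)"
  obtain f h k where "fm H \<beta> = (f, h, k)" by (cases "fm H \<beta>") auto
  \<comment> \<open>The base arrow is forced by the projection, and the two fibre maps are read off
    from the domain and codomain of the image of \<beta>; so H is determined by its action on
    objects.\<close>
  then show "fm H \<beta> = (fm (proj Q) \<beta>, snd (fo H (Dom (tot Q) \<beta>)), snd (fo H (Cod (tot Q) \<beta>)))"
    using H'(2)[OF \<beta>] H'(3,4)[OF \<beta>, symmetric] H'(10)[OF \<beta>] by (simp add: gexp_obj_simps)
qed

text \<open>The map whose bijectivity is the universal property of the exponential; it is also the
  first half of \<open>gexp_transpose\<close>.\<close>

definition gexp_uncurry where
  "gexp_uncurry Q S H = fcomp (tot (fprod P Q)) (gexp_eval X P S) (id_times P Q H)"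

lemma gexp_uncurry_in_slice_hom:
  assumes "Q \<in> slice_objs X" and "H \<in> slice_hom Q (gexp_obj X P S)"
  shows "gexp_uncurry Q S H \<in> slice_hom (fprod P Q) (Gamma_star_obj X S)"
  unfolding gexp_uncurry_def
  by (rule fcomp_in_slice_hom[OF fprod_in_slice_objs[OF P_obj assms(1)]
        Gamma_star_obj_in_slice_objs[OF category_axioms]
        id_times_in_slice_hom[OF P_obj assms(1) gexp_obj_in_slice_objs assms(2)]
        gexp_eval_in_slice_hom])

lemma gexp_uncurry_fo:
  assumes "Q \<in> slice_objs X" and H: "H \<in> slice_hom Q (gexp_obj X P S)"
    and aq: "(a, q) \<in> Obj (tot (fprod P Q))"
  shows "fo (gexp_uncurry Q S H) (a, q) = (snd (fo H q) a, fo (proj Q) q)"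
proof -
  have q: "q \<in> Obj (tot Q)" using aq by (simp add: fprod_simps)
  show ?thesis
    \<comment> \<open>Evaluation is computed on triples, so \<open>fo H q\<close> is first exhibited
      as a pair by \<open>gexp_hom_fo\<close>.\<close>
    using fprod_map_obj[OF H aq]
    by (simp add: gexp_uncurry_def aq id_times_fo)
       (subst (asm) gexp_hom_fo[OF assms(1,2) q], subst gexp_hom_fo[OF assms(1,2) q], rule gexp_eval_fo)
qed

lemma gexp_uncurry_fo_fst:
  assumes "Q \<in> slice_objs X" and "H \<in> slice_hom Q (gexp_obj X P S)"
    and "q \<in> Obj (tot Q)" and "a \<in> fibre P (fo (proj Q) q)"
  shows "fst (fo (gexp_uncurry Q S H) (a, q)) = snd (fo H q) a"
  using assms gexp_uncurry_fo[OF assms(1,2), of a q] by (simp add: fprod_simps fibre_def)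

text \<open>The inverse of \<open>gexp_uncurry\<close>. Each fibre map is restricted to the fibre
  over the image of \<open>q\<close>, because members of \<open>gexp_objs\<close> are extensional
  there.\<close>

definition gexp_curry where
  "gexp_curry Q G = (let h = (\<lambda>q. \<lambda>a\<in>fibre P (fo (proj Q) q). fst (fo G (a, q)))
    in \<lparr>fo = (\<lambda>q\<in>Obj (tot Q). (fo (proj Q) q, h q)),
        fm = (\<lambda>\<beta>\<in>Arr (tot Q). (fm (proj Q) \<beta>, h (Dom (tot Q) \<beta>), h (Cod (tot Q) \<beta>)))\<rparr>)"

lemma gexp_curry_in_slice_hom:
  assumes Q: "Q \<in> slice_objs X" and G: "G \<in> slice_hom (fprod P Q) (Gamma_star_obj X S)"
  shows "gexp_curry Q G \<in> slice_hom Q (gexp_obj X P S)"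
proof -
  interpret Q: category "tot Q" using Q by (rule slice_objs_category)
  note q = functorsD[OF slice_objs_proj[OF Q]]
  define h where "h = (\<lambda>q. \<lambda>a\<in>fibre P (fo (proj Q) q). fst (fo G (a, q)))"
  have curry: "gexp_curry Q G = \<lparr>fo = (\<lambda>q\<in>Obj (tot Q). (fo (proj Q) q, h q)),
      fm = (\<lambda>\<beta>\<in>Arr (tot Q). (fm (proj Q) \<beta>, h (Dom (tot Q) \<beta>), h (Cod (tot Q) \<beta>)))\<rparr>"
    by (simp add: gexp_curry_def h_def Let_def)
  note PQ = fprod_in_slice_objs[OF P_obj Q]
  \<comment> \<open>Constancy of G along the arrow (\<alpha>, \<beta>) of the product. Taking
    \<beta> an identity gives the condition on objects of the exponential, a general \<beta> the
    condition on arrows.\<close>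
  have arr: "h (Dom (tot Q) \<beta>) (Dom (tot P) \<alpha>) = h (Cod (tot Q) \<beta>) (Cod (tot P) \<alpha>)"
    if "\<alpha> \<in> Arr (tot P)" "\<beta> \<in> Arr (tot Q)" "fm (proj P) \<alpha> = fm (proj Q) \<beta>" for \<alpha> \<beta>
    using Gamma_star_hom_arr[OF PQ G, of "(\<alpha>, \<beta>)"] fibre_Dom_Cod[OF that(1)] that
    by (simp add: fprod_simps h_def q)
  have objs: "(fo (proj Q) b, h b) \<in> gexp_objs X P S" if b: "b \<in> Obj (tot Q)" for b
  proof -
    have "fst (fo G (a, b)) \<in> S" if "a \<in> fibre P (fo (proj Q) b)" for a
      using Gamma_star_hom_fo_in[OF PQ G, of "(a, b)"] that b by (simp add: fprod_simps fibre_def)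
    moreover have "h b (Dom (tot P) \<alpha>) = h b (Cod (tot P) \<alpha>)"
      if "\<alpha> \<in> Arr (tot P)" "fm (proj P) \<alpha> = Id X (fo (proj Q) b)" for \<alpha>
      using arr[OF that(1) Q.Id_in[OF b]] that b by (simp add: q Q.Dom_Id Q.Cod_Id)
    ultimately show ?thesis using b by (auto simp: gexp_objs_def q h_def)
  qed
  have arrs: "(fm (proj Q) \<beta>, h (Dom (tot Q) \<beta>), h (Cod (tot Q) \<beta>)) \<in> gexp_arrs X P S"
    if "\<beta> \<in> Arr (tot Q)" for \<beta>
    using that objs[OF Q.Dom_in[OF that]] objs[OF Q.Cod_in[OF that]]
    by (auto simp: gexp_arrs_def q arr)
  show ?thesis
  proof (rule slice_homI[OF Q gexp_obj_in_slice_objs])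
    show "gexp_curry Q G \<in> functors (tot Q) (tot (gexp_obj X P S))"
      by (rule functorsI)
         (auto simp: curry gexp_obj_simps objs arrs q Q.Dom_in Q.Cod_in Q.Id_in Q.Dom_Id Q.Cod_Id
           Q.Comp_in Q.Dom_Comp Q.Cod_Comp)
  qed (auto simp: curry gexp_obj_simps objs arrs)
qed

text \<open>A map into the exponential is known from its fibre maps, and these are the values of the
  uncurried map, whence injectivity. For surjectivity it is enough that uncurrying
  \<open>gexp_curry Q G\<close> returns G.\<close>

lemma gexp_uncurry_bij:
  assumes Q: "Q \<in> slice_objs X"
  shows "bij_betw (gexp_uncurry Q S) (slice_hom Q (gexp_obj X P S))
    (slice_hom (fprod P Q) (Gamma_star_obj X S))"
proof (rule bij_betwI')
  interpret Q: category "tot Q" using Q by (rule slice_objs_category)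
  fix H K assume H: "H \<in> slice_hom Q (gexp_obj X P S)" and K: "K \<in> slice_hom Q (gexp_obj X P S)"
  show "gexp_uncurry Q S H = gexp_uncurry Q S K \<longleftrightarrow> H = K"
  proof
    assume eq: "gexp_uncurry Q S H = gexp_uncurry Q S K"
    have snd_eq: "snd (fo H q) = snd (fo K q)" if q: "q \<in> Obj (tot Q)" for q
    proof (rule PiE_ext[OF gexp_hom_value[OF Q H q] gexp_hom_value[OF Q K q]])
      show "snd (fo H q) a = snd (fo K q) a" if "a \<in> fibre P (fo (proj Q) q)" for a
        using gexp_uncurry_fo_fst[OF Q H q that] gexp_uncurry_fo_fst[OF Q K q that] by (simp add: eq)
    qed
    show "H = K"
    proof (rule slice_hom_eqI[OF H K])
      show "fo H q = fo K q" if "q \<in> Obj (tot Q)" for q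
        using snd_eq[OF that] gexp_hom_fo[OF Q H that] gexp_hom_fo[OF Q K that] by metis
      show "fm H \<beta> = fm K \<beta>" if "\<beta> \<in> Arr (tot Q)" for \<beta>
        by (simp add: gexp_hom_fm[OF Q H that] gexp_hom_fm[OF Q K that] snd_eq Q.Dom_in Q.Cod_in that)
    qed
  qed simp
next
  show "gexp_uncurry Q S H \<in> slice_hom (fprod P Q) (Gamma_star_obj X S)"
    if "H \<in> slice_hom Q (gexp_obj X P S)" for H
    using Q that by (rule gexp_uncurry_in_slice_hom)
next
  fix G assume G: "G \<in> slice_hom (fprod P Q) (Gamma_star_obj X S)"
  note PQ = fprod_in_slice_objs[OF P_obj Q]
  interpret PQ: category "tot (fprod P Q)" using PQ by (rule slice_objs_category)
  note C = gexp_curry_in_slice_hom[OF Q G]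
  note U = gexp_uncurry_in_slice_hom[OF Q C]
  \<comment> \<open>Only S-coordinates need comparing; the coordinates in X are forced by the
    projections.\<close>
  have fo_eq: "fo G p = fo (gexp_uncurry Q S (gexp_curry Q G)) p" if p: "p \<in> Obj (tot (fprod P Q))" for p
  proof -
    obtain a q where [simp]: "p = (a, q)" by fastforce
    have "fst (fo (gexp_uncurry Q S (gexp_curry Q G)) p) = fst (fo G p)"
      using p gexp_uncurry_fo[OF Q C, of a q]
      by (simp add: gexp_curry_def fprod_simps fibre_def)
    then show ?thesis
      using Gamma_star_hom_fo[OF PQ G p] Gamma_star_hom_fo[OF PQ U p] by metis
  qed
  have "G = gexp_uncurry Q S (gexp_curry Q G)"
    by (rule slice_hom_eqI[OF G U])
       (simp_all add: fo_eq Gamma_star_hom_fm[OF PQ G] Gamma_star_hom_fm[OF PQ U] PQ.Dom_in)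
  with C show "\<exists>H\<in>slice_hom Q (gexp_obj X P S). G = gexp_uncurry Q S H" ..
qed

lemma gexp_is_exponential:
  "is_exponential TYPE('o \<times> 'm) X P (Gamma_star_obj X S) (gexp_obj X P S) (gexp_eval X P S)"
  by (simp add: is_exponential_def gexp_obj_in_slice_objs gexp_eval_in_slice_hom
      gexp_uncurry_bij[unfolded gexp_uncurry_def[abs_def]])

lemma Gamma_star_map_in_slice_hom:
  assumes "u \<in> set_hom S T"
  shows "map_of_arr (fm (Gamma_star X) (S, u, T)) \<in> slice_hom (Gamma_star_obj X S) (Gamma_star_obj X T)"
proof -
  have uT: "u s \<in> T" if "s \<in> S" for s using assms that by (auto simp: set_hom_def)
  show ?thesis
  proof (rule slice_homI[OF Gamma_star_obj_in_slice_objs Gamma_star_obj_in_slice_objs])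
    show "map_of_arr (fm (Gamma_star X) (S, u, T)) \<in>
        functors (tot (Gamma_star_obj X S)) (tot (Gamma_star_obj X T))"
      by (rule functorsI)
         (auto simp: Gamma_star_def map_of_arr_def assms Gamma_star_obj_simps uT
           Dom_in Cod_in Id_in Comp_in)
  qed (unfold_locales, auto simp: Gamma_star_def map_of_arr_def assms Gamma_star_obj_simps uT)
qed

text \<open>Both composites in the compatibility of evaluation with \<open>u\<close> map into
  \<open>\<Gamma>\<^sup>*T\<close>, so they are compared by their T-coordinates on objects; at (a,
  x, h) each of these is \<open>u (h a)\<close>.\<close>

lemma gexp_is_exponential_of_Gamma_star:
  "is_exponential_of_Gamma_star TYPE('o \<times> 'm) X P (gexp X P) (gexp_eval X P :: 's set \<Rightarrow> _)"
proof -
  have "fcomp (tot (fprod P (gexp_obj X P S))) (gexp_eval X P T)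
      (id_times P (gexp_obj X P S) (gexp_map X P S u)) =
    fcomp (tot (fprod P (gexp_obj X P S))) (map_of_arr (fm (Gamma_star X) (S, u, T))) (gexp_eval X P S)"
    (is "?L = ?R") if u: "u \<in> set_hom S T" for S T :: "'s set" and u
  proof -
    let ?E = "fprod P (gexp_obj X P S)"
    note E = fprod_in_slice_objs[OF P_obj gexp_obj_in_slice_objs]
    interpret E: category "tot ?E" using E by (rule slice_objs_category)
    have T: "Gamma_star_obj X T \<in> slice_objs X"
      by (rule Gamma_star_obj_in_slice_objs[OF category_axioms])
    \<comment> \<open>By definition the left side is the uncurrying of
      \<open>gexp_map X P S u\<close>.\<close>
    have L: "?L \<in> slice_hom ?E (Gamma_star_obj X T)"
      using gexp_uncurry_in_slice_hom[OF gexp_obj_in_slice_objs gexp_map_in_slice_hom[OF u]]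
      by (simp add: gexp_uncurry_def)
    have R: "?R \<in> slice_hom ?E (Gamma_star_obj X T)"
      by (rule fcomp_in_slice_hom[OF E T gexp_eval_in_slice_hom Gamma_star_map_in_slice_hom[OF u]])
    have fst_eq: "fst (fo ?L p) = fst (fo ?R p)" if p: "p \<in> Obj (tot ?E)" for p
    proof -
      obtain a x h where [simp]: "p = (a, x, h)" by (cases p) auto
      have ah: "a \<in> fibre P x" "(x, h) \<in> gexp_objs X P S" using p by (auto simp: gexp_prod_objs)
      have "h a \<in> S" "x \<in> Obj X" using ah gexp_objsD(1,2)[OF ah(2)] by auto
      have "fst (fo ?L p) = snd (fo (gexp_map X P S u) (x, h)) a"
        using gexp_uncurry_fo_fst[OF gexp_obj_in_slice_objs gexp_map_in_slice_hom[OF u], of "(x, h)" a] ah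
        by (simp add: gexp_uncurry_def gexp_obj_simps)
      also have "\<dots> = u (h a)" using ah by (simp add: gexp_map_def compose_def)
      also have "\<dots> = fst (fo ?R p)"
        using p \<open>h a \<in> S\<close> \<open>x \<in> Obj X\<close> by (simp add: gexp_eval_fo Gamma_star_def map_of_arr_def u)
      finally show ?thesis .
    qed
    show ?thesis
    proof (rule slice_hom_eqI[OF L R])
      show "fo ?L p = fo ?R p" if "p \<in> Obj (tot ?E)" for p
        using fst_eq[OF that] Gamma_star_hom_fo[OF E L that] Gamma_star_hom_fo[OF E R that] by metis
      show "fm ?L p = fm ?R p" if "p \<in> Arr (tot ?E)" for p
        by (simp only: Gamma_star_hom_fm[OF E L that] Gamma_star_hom_fm[OF E R that]
            fst_eq[OF E.Dom_in[OF that]])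
    qed
  qed
  then show ?thesis
    by (simp add: is_exponential_of_Gamma_star_def gexp_in_functors gexp_is_exponential)
       (simp add: gexp_def Gamma_star_def gexp_is_exponential map_of_arr_def)
qed

section \<open>The adjunction between the tensor functor and
  \<open>(\<Gamma>\<^sup>*-)\<^sup>P\<close>\<close>

lemma gexp_transpose_eq: "gexp_transpose X P Q S H = Gamma_shriek_transpose (fprod P Q) (gexp_uncurry Q S H)"
  by (simp add: gexp_transpose_def gexp_uncurry_def)

text \<open>The composite of two bijections: currying, from
  \<open>Hom(Q, (\<Gamma>\<^sup>*S)\<^sup>P)\<close> to
  \<open>Hom(P \<times> Q, \<Gamma>\<^sup>*S)\<close>, and the adjunction between
  \<open>\<Gamma>\<^sub>!\<close> and \<open>\<Gamma>\<^sup>*\<close> at the object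
  \<open>P \<times> Q\<close>.\<close>

lemma gexp_transpose_bij:
  assumes Q: "Q \<in> slice_objs X"
  shows "bij_betw (gexp_transpose X P Q S) (slice_hom Q (gexp_obj X P S))
    (set_hom (components (tot (fprod P Q))) S)"
proof -
  have "bij_betw (Gamma_shriek_transpose (fprod P Q) \<circ> gexp_uncurry Q S)
      (slice_hom Q (gexp_obj X P S)) (set_hom (components (tot (fprod P Q))) S)"
    by (rule bij_betw_trans[OF gexp_uncurry_bij[OF Q]
          Gamma_shriek_transpose_bij[OF category_axioms fprod_in_slice_objs[OF P_obj Q]]])
  then show ?thesis by (simp add: gexp_transpose_eq[abs_def] comp_def)
qed

text \<open>Uncurrying puts the value of the fibre map into the S-coordinate, which the second
  transposition reads off at a representative. Both naturality conditions are checked with this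
  formula.\<close>

lemma gexp_transpose_component:
  assumes Q: "Q \<in> slice_objs X" and H: "H \<in> slice_hom Q (gexp_obj X P S)"
    and aq: "(a, q) \<in> Obj (tot (fprod P Q))"
  shows "gexp_transpose X P Q S H (component (tot (fprod P Q)) (a, q)) = snd (fo H q) a"
  by (simp add: gexp_transpose_eq gexp_uncurry_fo[OF assms] Gamma_shriek_transpose_component[OF
        fprod_in_slice_objs[OF P_obj Q] gexp_uncurry_in_slice_hom[OF Q H] aq])

lemma gexp_transpose_in_set_hom:
  assumes "Q \<in> slice_objs X" and "H \<in> slice_hom Q (gexp_obj X P S)"
  shows "gexp_transpose X P Q S H \<in> set_hom (components (tot (fprod P Q))) S"
  using gexp_transpose_bij[OF assms(1)] assms(2) by (rule bij_betw_apply)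

lemma gexp_is_complement:
  "is_complement X P (gexp X P) (gexp_transpose X P :: ('o, 'm, 'x, 'y) over \<Rightarrow> 's set \<Rightarrow> _)"
proof -
  \<comment> \<open>Naturality in Q: at (a, q) both sides are the fibre map of
    \<open>H (K q)\<close> evaluated at \<open>a\<close>.\<close>
  have nat_Q: "gexp_transpose X P Q' S (fcomp (tot Q') H K) =
      compose (components (tot (fprod P Q'))) (gexp_transpose X P Q S H)
        (map_of_arr (fm (ten X P) (Q', K, Q)))"
    if Q': "Q' \<in> slice_objs X" and Q: "Q \<in> slice_objs X" and K: "K \<in> slice_hom Q' Q"
      and H: "H \<in> slice_hom Q (gexp_obj X P S)"
    for Q' Q :: "('o, 'm, 'x, 'y) over" and K H and S :: "'s set"
  proof -
    note HK = fcomp_in_slice_hom[OF Q' gexp_obj_in_slice_objs K H]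
    show ?thesis
    proof (rule set_hom_components_eqI[OF gexp_transpose_in_set_hom[OF Q' HK]
          set_hom_compose[OF ten_map_in_set_hom[OF P_obj Q' Q K] gexp_transpose_in_set_hom[OF Q H]]])
      fix p assume p: "p \<in> Obj (tot (fprod P Q'))"
      obtain a q where [simp]: "p = (a, q)" by fastforce
      have "q \<in> Obj (tot Q')" using p by (simp add: fprod_simps)
      with p fprod_map_obj[OF K, of a q P]
      show "gexp_transpose X P Q' S (fcomp (tot Q') H K) (component (tot (fprod P Q')) p) =
        compose (components (tot (fprod P Q'))) (gexp_transpose X P Q S H)
          (map_of_arr (fm (ten X P) (Q', K, Q))) (component (tot (fprod P Q')) p)"
        by (simp add: gexp_transpose_component[OF Q' HK] gexp_transpose_component[OF Q H]
            ten_fm_component[OF P_obj Q' Q K] compose_def component_in_components)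
    qed
  qed
  \<comment> \<open>Naturality in S: with h the fibre map of \<open>H q\<close>, both sides are
    \<open>u (h a)\<close> at (a, q).\<close>
  have nat_S: "gexp_transpose X P Q T (fcomp (tot Q) (gexp_map X P S u) H) =
      compose (components (tot (fprod P Q))) u (gexp_transpose X P Q S H)"
    if Q: "Q \<in> slice_objs X" and u: "u \<in> set_hom S T" and H: "H \<in> slice_hom Q (gexp_obj X P S)"
    for Q :: "('o, 'm, 'x, 'y) over" and S T :: "'s set" and u H
  proof -
    note uH = fcomp_in_slice_hom[OF Q gexp_obj_in_slice_objs H gexp_map_in_slice_hom[OF u]]
    show ?thesis
    proof (rule set_hom_components_eqI[OF gexp_transpose_in_set_hom[OF Q uH]
          set_hom_compose[OF gexp_transpose_in_set_hom[OF Q H] u]])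
      fix p assume p: "p \<in> Obj (tot (fprod P Q))"
      obtain a q where [simp]: "p = (a, q)" by fastforce
      have q: "q \<in> Obj (tot Q)" and a: "a \<in> fibre P (fo (proj Q) q)"
        using p by (auto simp: fprod_simps fibre_def)
      obtain h where h: "fo H q = (fo (proj Q) q, h)" "(fo (proj Q) q, h) \<in> gexp_objs X P S"
        using gexp_hom_fo[OF Q H q] functors_fo[OF slice_hom_functor[OF H] q]
        by (metis gexp_obj_simps(1))
      then have "snd (fo (gexp_map X P S u) (fo H q)) a = u (h a)"
        using a by (simp add: gexp_map_def compose_def)
      then show "gexp_transpose X P Q T (fcomp (tot Q) (gexp_map X P S u) H) (component (tot (fprod P Q)) p) =
        compose (components (tot (fprod P Q))) u (gexp_transpose X P Q S H) (component (tot (fprod P Q)) p)"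
        using p q h(1)
        by (simp add: gexp_transpose_component[OF Q uH] gexp_transpose_component[OF Q H]
            compose_eq component_in_components)
    qed
  qed
  have [simp]: "fo (gexp X P) S = gexp_obj X P S" for S :: "'s set"
    by (simp add: gexp_def)
  have [simp]: "map_of_arr (fm (gexp X P) (S, u, T)) = gexp_map X P S u"
    if "u \<in> set_hom S T" for S T :: "'s set" and u
    using that by (simp add: gexp_def map_of_arr_def)
  show ?thesis
    unfolding is_complement_def right_adjoint_def
    using nat_Q nat_S
    by (simp add: ten_in_functors[OF P_obj] gexp_in_functors ten_fo P_obj gexp_transpose_bij)
qed

end


section \<open>Discrete fibrations and opfibrations\<close>

lemma discrete_fibration_lift:
  assumes "discrete_fibration X P" and "a \<in> Obj (tot P)" and "f \<in> Arr X" and "Cod X f = fo (proj P) a"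
  obtains \<alpha> where "\<alpha> \<in> Arr (tot P)" and "Cod (tot P) \<alpha> = a" and "fm (proj P) \<alpha> = f"
  using assms unfolding discrete_fibration_def by blast

text \<open>Both arrows lift the same arrow of X at the same codomain. In this form uniqueness
  identifies arrows of P from codomain and projection alone.\<close>

lemma discrete_fibration_unique:
  assumes "discrete_fibration X P" and "\<alpha> \<in> Arr (tot P)" and "\<beta> \<in> Arr (tot P)"
    and "Cod (tot P) \<alpha> = Cod (tot P) \<beta>" and "fm (proj P) \<alpha> = fm (proj P) \<beta>"
  shows "\<alpha> = \<beta>"
proof -
  have P: "P \<in> slice_objs X" using assms(1) by (simp add: discrete_fibration_def)
  have "Cod (tot P) \<beta> \<in> Obj (tot P)" "fm (proj P) \<beta> \<in> Arr X"
    "Cod X (fm (proj P) \<beta>) = fo (proj P) (Cod (tot P) \<beta>)"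
    using assms(3) category.Cod_in[OF slice_objs_category[OF P]] functorsD[OF slice_objs_proj[OF P]]
    by auto
  with assms show ?thesis unfolding discrete_fibration_def by metis
qed

lemma discrete_opfibration_lift:
  assumes "discrete_opfibration X P" and "a \<in> Obj (tot P)" and "f \<in> Arr X" and "Dom X f = fo (proj P) a"
  obtains \<alpha> where "\<alpha> \<in> Arr (tot P)" and "Dom (tot P) \<alpha> = a" and "fm (proj P) \<alpha> = f"
  using assms unfolding discrete_opfibration_def by blast

lemma discrete_opfibration_unique:
  assumes "discrete_opfibration X P" and "\<alpha> \<in> Arr (tot P)" and "\<beta> \<in> Arr (tot P)"
    and "Dom (tot P) \<alpha> = Dom (tot P) \<beta>" and "fm (proj P) \<alpha> = fm (proj P) \<beta>"
  shows "\<alpha> = \<beta>"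
proof -
  have P: "P \<in> slice_objs X" using assms(1) by (simp add: discrete_opfibration_def)
  have "Dom (tot P) \<beta> \<in> Obj (tot P)" "fm (proj P) \<beta> \<in> Arr X"
    "Dom X (fm (proj P) \<beta>) = fo (proj P) (Dom (tot P) \<beta>)"
    using assms(3) category.Dom_in[OF slice_objs_category[OF P]] functorsD[OF slice_objs_proj[OF P]]
    by auto
  with assms show ?thesis unfolding discrete_opfibration_def by metis
qed

text \<open>Lift g at the codomain of \<alpha> to \<gamma>, then f at the domain of \<gamma> to
  \<beta>. The composite lies over \<open>Comp X g f\<close> and has the codomain of \<alpha>, so by
  uniqueness it is \<alpha>, and \<beta> starts where \<alpha> does.\<close>

lemma discrete_fibration_factorization_lifting:
  assumes "category X" and df: "discrete_fibration X P"
  shows "factorization_lifting X P"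
proof -
  interpret X: category X by fact
  have P: "P \<in> slice_objs X" using df by (simp add: discrete_fibration_def)
  interpret P: category "tot P" using P by (rule slice_objs_category)
  note p = functorsD[OF slice_objs_proj[OF P]]
  show ?thesis
  proof unfold_locales
    fix \<alpha> f g assume \<alpha>: "\<alpha> \<in> Arr (tot P)" and f: "f \<in> Arr X" and g: "g \<in> Arr X"
      and fg: "Cod X f = Dom X g" and eq: "fm (proj P) \<alpha> = Comp X g f"
    have "Cod X g = fo (proj P) (Cod (tot P) \<alpha>)"
      using p(4)[OF \<alpha>] by (simp add: eq X.Cod_Comp f g fg)
    then obtain \<gamma> where \<gamma>: "\<gamma> \<in> Arr (tot P)" "Cod (tot P) \<gamma> = Cod (tot P) \<alpha>" "fm (proj P) \<gamma> = g"
      using discrete_fibration_lift[OF df P.Cod_in[OF \<alpha>] g] by metis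
    have "Cod X f = fo (proj P) (Dom (tot P) \<gamma>)"
      using p(3)[OF \<gamma>(1)] by (simp add: \<gamma> fg)
    then obtain \<beta> where \<beta>: "\<beta> \<in> Arr (tot P)" "Cod (tot P) \<beta> = Dom (tot P) \<gamma>" "fm (proj P) \<beta> = f"
      using discrete_fibration_lift[OF df P.Dom_in[OF \<gamma>(1)] f] by metis
    have "Comp (tot P) \<gamma> \<beta> = \<alpha>"
      by (rule discrete_fibration_unique[OF df]) (simp_all add: \<alpha> \<beta> \<gamma> P.Comp_in P.Cod_Comp p eq)
    then have "Dom (tot P) \<beta> = Dom (tot P) \<alpha>"
      using P.Dom_Comp[of \<beta> \<gamma>] \<beta> \<gamma> by simp
    with \<beta> \<gamma> show "\<exists>\<beta> \<gamma>. \<beta> \<in> Arr (tot P) \<and> \<gamma> \<in> Arr (tot P) \<and> fm (proj P) \<beta> = f \<and>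
        fm (proj P) \<gamma> = g \<and> Dom (tot P) \<beta> = Dom (tot P) \<alpha> \<and> Cod (tot P) \<beta> = Dom (tot P) \<gamma> \<and>
        Cod (tot P) \<gamma> = Cod (tot P) \<alpha>" by blast
  qed fact
qed

text \<open>Dually, lifting begins at the other end: first f at the domain of \<alpha>, then g at
  the codomain of that lift. Uniqueness identifies the composite with \<alpha> and so yields the
  codomain.\<close>

lemma discrete_opfibration_factorization_lifting:
  assumes "category X" and dof: "discrete_opfibration X P"
  shows "factorization_lifting X P"
proof -
  interpret X: category X by fact
  have P: "P \<in> slice_objs X" using dof by (simp add: discrete_opfibration_def)
  interpret P: category "tot P" using P by (rule slice_objs_category)
  note p = functorsD[OF slice_objs_proj[OF P]]
  show ?thesis
  proof unfold_locales
    fix \<alpha> f g assume \<alpha>: "\<alpha> \<in> Arr (tot P)" and f: "f \<in> Arr X" and g: "g \<in> Arr X"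
      and fg: "Cod X f = Dom X g" and eq: "fm (proj P) \<alpha> = Comp X g f"
    have "Dom X f = fo (proj P) (Dom (tot P) \<alpha>)"
      using p(3)[OF \<alpha>] by (simp add: eq X.Dom_Comp f g fg)
    then obtain \<beta> where \<beta>: "\<beta> \<in> Arr (tot P)" "Dom (tot P) \<beta> = Dom (tot P) \<alpha>" "fm (proj P) \<beta> = f"
      using discrete_opfibration_lift[OF dof P.Dom_in[OF \<alpha>] f] by metis
    have "Dom X g = fo (proj P) (Cod (tot P) \<beta>)"
      using p(4)[OF \<beta>(1)] by (simp add: \<beta> fg)
    then obtain \<gamma> where \<gamma>: "\<gamma> \<in> Arr (tot P)" "Dom (tot P) \<gamma> = Cod (tot P) \<beta>" "fm (proj P) \<gamma> = g"
      using discrete_opfibration_lift[OF dof P.Cod_in[OF \<beta>(1)] g] by metis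
    have "Comp (tot P) \<gamma> \<beta> = \<alpha>"
      by (rule discrete_opfibration_unique[OF dof]) (simp_all add: \<alpha> \<beta> \<gamma> P.Comp_in P.Dom_Comp p eq)
    then have "Cod (tot P) \<gamma> = Cod (tot P) \<alpha>"
      using P.Cod_Comp[of \<beta> \<gamma>] \<beta> \<gamma> by simp
    with \<beta> \<gamma> show "\<exists>\<beta> \<gamma>. \<beta> \<in> Arr (tot P) \<and> \<gamma> \<in> Arr (tot P) \<and> fm (proj P) \<beta> = f \<and>
        fm (proj P) \<gamma> = g \<and> Dom (tot P) \<beta> = Dom (tot P) \<alpha> \<and> Cod (tot P) \<beta> = Dom (tot P) \<gamma> \<and>
        Cod (tot P) \<gamma> = Cod (tot P) \<alpha>"
      by (intro exI[of _ \<beta>] exI[of _ \<gamma>]) simp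
  qed fact
qed

text \<open>Lifting f at prescribed codomains maps the fibre over \<open>Cod X f\<close> to the
  fibre over \<open>Dom X f\<close>. An arrow over f out of h is forced to end at h precomposed with
  this map, which gives both existence and uniqueness.\<close>

lemma gexp_discrete_opfibration:
  assumes "category X" and df: "discrete_fibration X P"
  shows "discrete_opfibration X (gexp_obj X P S)"
proof -
  interpret factorization_lifting X P
    using assms by (rule discrete_fibration_factorization_lifting)
  interpret P: category "tot P" using P_obj by (rule slice_objs_category)
  note p = functorsD[OF slice_objs_proj[OF P_obj]]
  have lift: "\<exists>!\<phi>. \<phi> \<in> Arr (tot (gexp_obj X P S)) \<and> Dom (tot (gexp_obj X P S)) \<phi> = (Dom X f, h) \<and>
      fm (proj (gexp_obj X P S)) \<phi> = f"
    if h: "(Dom X f, h) \<in> gexp_objs X P S" and f: "f \<in> Arr X" for f h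
  proof -
    have ex: "\<exists>\<alpha>. \<alpha> \<in> Arr (tot P) \<and> Cod (tot P) \<alpha> = c \<and> fm (proj P) \<alpha> = f"
      if "c \<in> fibre P (Cod X f)" for c
      using discrete_fibration_lift[OF df _ f, of c] that by (auto simp: fibre_def)
    \<comment> \<open>The choice is of the unique lift of f ending at \<open>c\<close>, for
      \<open>c\<close> in the fibre over \<open>Cod X f\<close>.\<close>
    define l where "l = (\<lambda>c. SOME \<alpha>. \<alpha> \<in> Arr (tot P) \<and> Cod (tot P) \<alpha> = c \<and> fm (proj P) \<alpha> = f)"
    have l: "l c \<in> Arr (tot P)" "Cod (tot P) (l c) = c" "fm (proj P) (l c) = f"
      if "c \<in> fibre P (Cod X f)" for c
      using someI_ex[OF ex[OF that]] by (simp_all add: l_def)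
    define k where "k = (\<lambda>c\<in>fibre P (Cod X f). h (Dom (tot P) (l c)))"
    have k: "h (Dom (tot P) \<alpha>) = k (Cod (tot P) \<alpha>)" if \<alpha>: "\<alpha> \<in> Arr (tot P)" "fm (proj P) \<alpha> = f" for \<alpha>
    proof -
      have c: "Cod (tot P) \<alpha> \<in> fibre P (Cod X f)" using fibre_Dom_Cod[OF \<alpha>(1)] \<alpha>(2) by simp
      \<comment> \<open>Every arrow over f is one of the chosen lifts, so the condition built into k
        covers all of them.\<close>
      have "l (Cod (tot P) \<alpha>) = \<alpha>"
        by (rule discrete_fibration_unique[OF df]) (simp_all add: l[OF c] \<alpha>)
      then show ?thesis by (simp add: k_def c)
    qed
    have "k \<in> fibre P (Cod X f) \<rightarrow>\<^sub>E S"
    proof -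
      have "h (Dom (tot P) (l c)) \<in> S" if "c \<in> fibre P (Cod X f)" for c
        using fibre_Dom_Cod(1)[OF l(1)[OF that]] gexp_objsD(2)[OF h] l(3)[OF that] by auto
      then show ?thesis by (simp add: k_def)
    qed
    \<comment> \<open>Arrows over identities are identities by uniqueness of lifts, so constancy
      along them is automatic.\<close>
    moreover have "k (Dom (tot P) \<alpha>) = k (Cod (tot P) \<alpha>)"
      if \<alpha>: "\<alpha> \<in> Arr (tot P)" "fm (proj P) \<alpha> = Id X (Cod X f)" for \<alpha>
    proof -
      have "fo (proj P) (Cod (tot P) \<alpha>) = Cod X f"
        using p(4)[OF \<alpha>(1)] by (simp add: \<alpha>(2) Cod_Id Cod_in f)
      then have "Id (tot P) (Cod (tot P) \<alpha>) = \<alpha>"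
        by (intro discrete_fibration_unique[OF df]) (simp_all add: \<alpha> P.Id_in P.Cod_Id P.Cod_in p)
      then show ?thesis using P.Dom_Id[OF P.Cod_in[OF \<alpha>(1)]] by simp
    qed
    ultimately have arr: "(f, h, k) \<in> gexp_arrs X P S"
      using h f k by (simp add: gexp_arrs_def gexp_objs_def Cod_in)
    \<comment> \<open>The arrow condition at the lift of f ending at \<open>c\<close> prescribes the
      value at \<open>c\<close> of any target map.\<close>
    have uniq: "k' = k" if k': "(f, h, k') \<in> gexp_arrs X P S" for k'
    proof (rule PiE_ext[OF gexp_objsD(2)[OF gexp_arrsD(3)[OF k']] gexp_objsD(2)[OF gexp_arrsD(3)[OF arr]]])
      show "k' c = k c" if "c \<in> fibre P (Cod X f)" for c
        using gexp_arrsD(4)[OF k' l(1,3)[OF that]] l(2)[OF that] that by (simp add: k_def)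
    qed
    show ?thesis
    proof (rule ex1I[of _ "(f, h, k)"], goal_cases)
      case 1
      show ?case using arr by (simp add: gexp_obj_simps)
    next
      case (2 \<phi>)
      obtain f' h' k' where "\<phi> = (f', h', k')" by (cases \<phi>) auto
      with 2 uniq[of k'] show ?case by (auto simp: gexp_obj_simps)
    qed
  qed
  show ?thesis
    unfolding discrete_opfibration_def
  proof (intro conjI ballI impI gexp_obj_in_slice_objs)
    fix a f assume a: "a \<in> Obj (tot (gexp_obj X P S))" and f: "f \<in> Arr X"
      and eq: "Dom X f = fo (proj (gexp_obj X P S)) a"
    obtain x h where xh: "a = (x, h)" by fastforce
    with a have "(x, h) \<in> gexp_objs X P S" by (simp add: gexp_obj_simps)
    moreover from this have "Dom X f = x" by (simp add: eq xh gexp_obj_simps)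
    ultimately
    show "\<exists>!\<phi>. \<phi> \<in> Arr (tot (gexp_obj X P S)) \<and> Dom (tot (gexp_obj X P S)) \<phi> = a \<and>
        fm (proj (gexp_obj X P S)) \<phi> = f" using lift[OF _ f, of h] by (simp only: xh)
  qed
qed

text \<open>Lifting f at prescribed domains now maps the fibre over \<open>Dom X f\<close> to the
  fibre over \<open>Cod X f\<close>, so an arrow over f into k is forced to start at k precomposed
  with this map.\<close>

lemma gexp_discrete_fibration:
  assumes "category X" and dof: "discrete_opfibration X P"
  shows "discrete_fibration X (gexp_obj X P S)"
proof -
  interpret factorization_lifting X P
    using assms by (rule discrete_opfibration_factorization_lifting)
  interpret P: category "tot P" using P_obj by (rule slice_objs_category)
  note p = functorsD[OF slice_objs_proj[OF P_obj]]
  have lift: "\<exists>!\<phi>. \<phi> \<in> Arr (tot (gexp_obj X P S)) \<and> Cod (tot (gexp_obj X P S)) \<phi> = (Cod X f, k) \<and>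
      fm (proj (gexp_obj X P S)) \<phi> = f"
    if k: "(Cod X f, k) \<in> gexp_objs X P S" and f: "f \<in> Arr X" for f k
  proof -
    have ex: "\<exists>\<alpha>. \<alpha> \<in> Arr (tot P) \<and> Dom (tot P) \<alpha> = a \<and> fm (proj P) \<alpha> = f"
      if "a \<in> fibre P (Dom X f)" for a
      using discrete_opfibration_lift[OF dof _ f, of a] that by (auto simp: fibre_def)
    define l where "l = (\<lambda>a. SOME \<alpha>. \<alpha> \<in> Arr (tot P) \<and> Dom (tot P) \<alpha> = a \<and> fm (proj P) \<alpha> = f)"
    have l: "l a \<in> Arr (tot P)" "Dom (tot P) (l a) = a" "fm (proj P) (l a) = f"
      if "a \<in> fibre P (Dom X f)" for a
      using someI_ex[OF ex[OF that]] by (simp_all add: l_def)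
    \<comment> \<open>The precomposite, with \<open>l a\<close> the unique lift of f starting at
      \<open>a\<close>.\<close>
    define h where "h = (\<lambda>a\<in>fibre P (Dom X f). k (Cod (tot P) (l a)))"
    have h: "h (Dom (tot P) \<alpha>) = k (Cod (tot P) \<alpha>)" if \<alpha>: "\<alpha> \<in> Arr (tot P)" "fm (proj P) \<alpha> = f" for \<alpha>
    proof -
      have a: "Dom (tot P) \<alpha> \<in> fibre P (Dom X f)" using fibre_Dom_Cod[OF \<alpha>(1)] \<alpha>(2) by simp
      have "l (Dom (tot P) \<alpha>) = \<alpha>"
        by (rule discrete_opfibration_unique[OF dof]) (simp_all add: l[OF a] \<alpha>)
      then show ?thesis by (simp add: h_def a)
    qed
    have "h \<in> fibre P (Dom X f) \<rightarrow>\<^sub>E S"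
    proof -
      have "k (Cod (tot P) (l a)) \<in> S" if "a \<in> fibre P (Dom X f)" for a
        using fibre_Dom_Cod(2)[OF l(1)[OF that]] gexp_objsD(2)[OF k] l(3)[OF that] by auto
      then show ?thesis by (simp add: h_def)
    qed
    \<comment> \<open>Again a vertical arrow is an identity, here by comparison with the identity of
      its domain.\<close>
    moreover have "h (Dom (tot P) \<alpha>) = h (Cod (tot P) \<alpha>)"
      if \<alpha>: "\<alpha> \<in> Arr (tot P)" "fm (proj P) \<alpha> = Id X (Dom X f)" for \<alpha>
    proof -
      have "fo (proj P) (Dom (tot P) \<alpha>) = Dom X f"
        using p(3)[OF \<alpha>(1)] by (simp add: \<alpha>(2) Dom_Id Dom_in f)
      then have "Id (tot P) (Dom (tot P) \<alpha>) = \<alpha>"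
        by (intro discrete_opfibration_unique[OF dof]) (simp_all add: \<alpha> P.Id_in P.Dom_Id P.Dom_in p)
      then show ?thesis using P.Cod_Id[OF P.Dom_in[OF \<alpha>(1)]] by simp
    qed
    ultimately have arr: "(f, h, k) \<in> gexp_arrs X P S"
      using h f k by (simp add: gexp_arrs_def gexp_objs_def Dom_in)
    \<comment> \<open>The arrow condition at the lift of f starting at \<open>a\<close> prescribes
      the value at \<open>a\<close> of any source map.\<close>
    have uniq: "h' = h" if h': "(f, h', k) \<in> gexp_arrs X P S" for h'
    proof (rule PiE_ext[OF gexp_objsD(2)[OF gexp_arrsD(2)[OF h']] gexp_objsD(2)[OF gexp_arrsD(2)[OF arr]]])
      show "h' a = h a" if "a \<in> fibre P (Dom X f)" for a
        using gexp_arrsD(4)[OF h' l(1,3)[OF that]] l(2)[OF that] that by (simp add: h_def)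
    qed
    show ?thesis
    proof (rule ex1I[of _ "(f, h, k)"], goal_cases)
      case 1
      show ?case using arr by (simp add: gexp_obj_simps)
    next
      case (2 \<phi>)
      obtain f' h' k' where "\<phi> = (f', h', k')" by (cases \<phi>) auto
      with 2 uniq[of h'] show ?case by (auto simp: gexp_obj_simps)
    qed
  qed
  show ?thesis
    unfolding discrete_fibration_def
  proof (intro conjI ballI impI gexp_obj_in_slice_objs)
    fix a f assume a: "a \<in> Obj (tot (gexp_obj X P S))" and f: "f \<in> Arr X"
      and eq: "Cod X f = fo (proj (gexp_obj X P S)) a"
    obtain x h where xh: "a = (x, h)" by fastforce
    with a have "(x, h) \<in> gexp_objs X P S" by (simp add: gexp_obj_simps)
    moreover from this have "Cod X f = x" by (simp add: eq xh gexp_obj_simps)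
    ultimately
    show "\<exists>!\<phi>. \<phi> \<in> Arr (tot (gexp_obj X P S)) \<and> Cod (tot (gexp_obj X P S)) \<phi> = a \<and>
        fm (proj (gexp_obj X P S)) \<phi> = f" using lift[OF _ f, of h] by (simp only: xh)
  qed
qed

theorem proposition14:
  fixes X :: "('x, 'y) cat"
    and A :: "('a, 'b, 'x, 'y) over"
    and D :: "('c, 'd, 'x, 'y) over"
  assumes "category X"
  shows "(discrete_fibration X A \<longrightarrow>
            is_complement X A (gexp X A)
              (gexp_transpose X A :: ('o, 'm, 'x, 'y) over \<Rightarrow> 's set \<Rightarrow> _) \<and>
            is_exponential_of_Gamma_star TYPE('o \<times> 'm) X A (gexp X A)
              (gexp_eval X A :: 's set \<Rightarrow> _) \<and>
            (\<forall>S :: 's set. discrete_opfibration X (fo (gexp X A) S))) \<and>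
         (discrete_opfibration X D \<longrightarrow>
            is_complement X D (gexp X D)
              (gexp_transpose X D :: ('o, 'm, 'x, 'y) over \<Rightarrow> 's set \<Rightarrow> _) \<and>
            is_exponential_of_Gamma_star TYPE('o \<times> 'm) X D (gexp X D)
              (gexp_eval X D :: 's set \<Rightarrow> _) \<and>
            (\<forall>S :: 's set. discrete_fibration X (fo (gexp X D) S)))"
proof (intro conjI impI allI)
  assume A: "discrete_fibration X A"
  \<comment> \<open>The adjunction and the exponential come from the construction shared by both
    variances; the kind of fibration formed by the values depends on the direction of the
    lifts.\<close>
  interpret factorization_lifting X A
    using assms A by (rule discrete_fibration_factorization_lifting)
  show "is_complement X A (gexp X A) (gexp_transpose X A :: ('o, 'm, 'x, 'y) over \<Rightarrow> 's set \<Rightarrow> _)"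
    by (rule gexp_is_complement)
  show "is_exponential_of_Gamma_star TYPE('o \<times> 'm) X A (gexp X A) (gexp_eval X A :: 's set \<Rightarrow> _)"
    by (rule gexp_is_exponential_of_Gamma_star)
  show "discrete_opfibration X (fo (gexp X A) S)" for S :: "'s set"
    using gexp_discrete_opfibration[OF assms A] by (simp add: gexp_def)
next
  assume D: "discrete_opfibration X D"
  interpret factorization_lifting X D
    using assms D by (rule discrete_opfibration_factorization_lifting)
  show "is_complement X D (gexp X D) (gexp_transpose X D :: ('o, 'm, 'x, 'y) over \<Rightarrow> 's set \<Rightarrow> _)"
    by (rule gexp_is_complement)
  show "is_exponential_of_Gamma_star TYPE('o \<times> 'm) X D (gexp X D) (gexp_eval X D :: 's set \<Rightarrow> _)"
    by (rule gexp_is_exponential_of_Gamma_star)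
  show "discrete_fibration X (fo (gexp X D) S)" for S :: "'s set"
    using gexp_discrete_fibration[OF assms D] by (simp add: gexp_def)
qed

end
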